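(* Let $(U,g)$ be a metric structure with Levi-Civita derivatives $D_a^{\pm}$. For all $X\in\mathcal{M}(U)$, the metric covariant divergence satisfies $$D^{-}\lrcorner_{g^{-1}}X=\underline{g}(D^{+}\lrcorner\underline{g}^{-1}(X)),\qquad D^{-}\lrcorner_{g^{-1}}X=\frac{1}{\sqrt{|\det[g]|}}\,\underline{g}\Bigl(\partial_o\lrcorner\bigl(\sqrt{|\det[g]|}\,\underline{g}^{-1}(X)\bigr)\Bigr),$$ and hence $D^{-}\lrcorner_{g^{-1}}X=-\underset{g}{\delta}X$, where $\underset{g}{\delta}$ is the metric Hodge coderivative operator.
   Context: $M$ is an $n$-dimensional smooth manifold, $(U_o,\phi_o)$ a chart with coordinates $x^1,\dots,x^n$, and $U\subset U_o$ open. The canonical space $\mathcal{U}_o$ is an $n$-dimensional real vector space with basis $b_1,\dots,b_n$ and the Euclidean scalar product $b_\mu\cdot b_\nu=\delta_{\mu\nu}$, extended to $\bigwedge\mathcal{U}_o$ by $(v_1\wedge\dots\wedge v_k)\cdot(w_1\wedge\dots\wedge w_k)=\det(v_i\cdot w_j)$, different grades being orthogonal. $\mathcal{M}(U)$ denotes the smooth maps $U\to\bigwedge\mathcal{U}_o$. For $a\in\mathcal{U}_o$, $a\cdot\partial_o X=\sum_\mu(a\cdot b_\mu)\,\partial X/\partial x^\mu$; for an endomorphism field $g$, $(a\cdot\partial_og)(b)=a\cdot\partial_o(g(b))-g(a\cdot\partial_ob)$. On grade $k$: $\widehat X=(-1)^kX$, $\widetilde X=(-1)^{k(k-1)/2}X$.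 Left contraction: $(X\lrcorner Y)\cdot Z=Y\cdot(\widetilde X\wedge Z)$ for all $Z$. $\partial_o\lrcorner X=\sum_\mu b_\mu\lrcorner\partial X/\partial x^\mu$, $\partial_o\wedge X=\sum_\mu b_\mu\wedge\partial X/\partial x^\mu$. ${}^\dagger$ is the Euclidean adjoint, $\underline t$ the exterior-algebra extension of $t$. Metric structure $(U,g)$: $g$ is a smooth field of endomorphisms of $\mathcal{U}_o$ with $g=g^\dagger$, $\det[g]\ne0$ everywhere. Levi-Civita connection field: $\lambda_a(b)=\frac12g^{-1}\circ(a\cdot\partial_og)(b)+\omega_0(a)\times_gb$ with $\omega_0(a)=-\frac14\sum_{\mu,\nu}a\cdot((b_\mu\cdot\partial_og)(b_\nu)-(b_\nu\cdot\partial_og)(b_\mu))\,g^{-1}(b_\mu)\wedge g^{-1}(b_\nu)$ and $B\times_gb=-g(b)\lrcorner B$; $\Lambda_a(X)=\sum_\mu\lambda_a(b_\mu)\wedge(b_\mu\lrcorner X)$; $D_a^{+}X=a\cdot\partial_oX+\Lambda_a(X)$, $D_a^{-}X=a\cdot\partial_oX-\Lambda_a^{\dagger}(X)$. $D^{+}\lrcorner X=\sum_\mu b_\mu\lrcorner(D_{b_\mu}^{+}X)$ and $D^{-}\lrcorner_{g^{-1}}X=\sum_\mu g^{-1}(b_\mu)\lrcorner(D_{b_\mu}^{-}X)$. Metric Hodge coderivative: $\underset{g}{\delta}X=\underset{g}{\star}^{-1}(\partial_o\wedge(\underset{g}{\star}\widehat X))$, where $\underset{g}{\star}X=\sqrt{|\det[g]|}\,\underline{g}^{-1}(\widetilde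 X)\lrcorner\tau$ and $\tau=\sqrt{e_\wedge\cdot e_\wedge}\,e^\wedge$ for a pair of reciprocal frame fields $(\{e_\mu\},\{e^\mu\})$ on $U$, $e_\wedge=e_1\wedge\dots\wedge e_n$, $e^\wedge=e^1\wedge\dots\wedge e^n$ (so $\tau=\pm b_1\wedge\dots\wedge b_n$). *)

theory Defs
  imports "HOL-Analysis.Analysis"
begin

section \<open>Smooth maps and smooth manifolds\<close>

fun C_k_on :: "nat \<Rightarrow> 'a::real_normed_vector set \<Rightarrow> ('a \<Rightarrow> 'b::real_normed_vector) \<Rightarrow> bool" where
  "C_k_on 0 S f \<longleftrightarrow> continuous_on S f"
| "C_k_on (Suc k) S f \<longleftrightarrow>
     (\<forall>x\<in>S. f differentiable (at x)) \<and>
     (\<forall>v. C_k_on k S (\<lambda>x. frechet_derivative f (at x) v))"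

text \<open>Only meant for open \<open>S\<close>, since derivatives are taken with respect to \<open>at x\<close>.\<close>

definition smooth_on :: "'a::real_normed_vector set \<Rightarrow> ('a \<Rightarrow> 'b::real_normed_vector) \<Rightarrow> bool" where
  "smooth_on S f \<longleftrightarrow> (\<forall>k. C_k_on k S f)"

text \<open>
  A chart is a pair of a domain and a coordinate map. The dimension of the manifold is the
  cardinality of the index type \<open>'n\<close>; its linear order provides the ordering \<open>b\<^sub>1, \<dots>, b\<^sub>n\<close> of the
  basis, which enters the exterior algebra below.
\<close>

type_synonym 'n canonical_space = "real ^ 'n"

type_synonym ('m, 'n) chart = "'m set \<times> ('m \<Rightarrow> 'n canonical_space)"

definition chart_inv :: "('m, 'n) chart \<Rightarrow> 'n canonical_space \<Rightarrow> 'm" where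
  "chart_inv c = inv_into (fst c) (snd c)"

definition topological_chart :: "('m::topological_space, 'n::finite) chart \<Rightarrow> bool" where
  "topological_chart c \<longleftrightarrow>
     open (fst c) \<and> open (snd c ` fst c) \<and>
     homeomorphism (fst c) (snd c ` fst c) (snd c) (chart_inv c)"

definition smoothly_compatible :: "('m, 'n::finite) chart \<Rightarrow> ('m, 'n) chart \<Rightarrow> bool" where
  "smoothly_compatible c d \<longleftrightarrow>
     smooth_on (snd c ` (fst c \<inter> fst d)) (snd d \<circ> chart_inv c) \<and>
     smooth_on (snd d ` (fst c \<inter> fst d)) (snd c \<circ> chart_inv d)"

definition smooth_atlas :: "('m::topological_space, 'n::finite) chart set \<Rightarrow> bool" where
  "smooth_atlas \<A> \<longleftrightarrow>
     (\<forall>c\<in>\<A>. topological_chart c) \<and>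
     (\<Union>c\<in>\<A>. fst c) = UNIV \<and>
     (\<forall>c\<in>\<A>. \<forall>d\<in>\<A>. smoothly_compatible c d)"

definition chart_of :: "('m::topological_space, 'n::finite) chart set \<Rightarrow> ('m, 'n) chart \<Rightarrow> bool" where
  "chart_of \<A> c \<longleftrightarrow> topological_chart c \<and> (\<forall>d\<in>\<A>. smoothly_compatible c d)"


section \<open>The exterior algebra of the canonical space\<close>

text \<open>
  The canonical space is \<open>real ^ 'n\<close>. Its exterior algebra has the basis of blades
  \<open>b\<^sub>A = b\<^bsub>i1\<^esub> \<and> \<dots> \<and> b\<^bsub>ik\<^esub>\<close> with \<open>i1 < \<dots> < ik\<close> the elements of \<open>A\<close>, and a multivector is the family of
  its coordinates in this basis. The Gram determinant formula for the scalar product makes this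
  basis orthonormal, so the scalar product is the library's inner product; see
  \<open>inner_wedge_fam\<close> below.
\<close>

type_synonym 'n multivector = "real ^ 'n set"

definition bvec :: "'n \<Rightarrow> ('n::finite) canonical_space" where
  "bvec \<mu> = axis \<mu> 1"

definition blade :: "'n set \<Rightarrow> ('n::finite) multivector" where
  "blade A = axis A 1"

definition of_vec :: "'n canonical_space \<Rightarrow> ('n::finite) multivector" where
  "of_vec v = (\<Sum>\<mu>\<in>UNIV. (v $ \<mu>) *\<^sub>R blade {\<mu>})"

definition inversions :: "'n::linorder set \<Rightarrow> 'n set \<Rightarrow> nat" where
  "inversions A B = card {(i, j). i \<in> A \<and> j \<in> B \<and> j < i}"

text \<open>On blades: \<open>b\<^sub>A \<and> b\<^sub>B\<close> is zero unless \<open>A\<close> and \<open>B\<close> are disjoint, and \<open>(-1)\<close> to the number of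
  inversions times \<open>b\<^bsub>A \<union> B\<^esub>\<close> if they are.\<close>

definition wedge ::
  "('n::{finite,linorder}) multivector \<Rightarrow> 'n multivector \<Rightarrow> 'n multivector" (infixr \<open>\<^bold>\<and>\<close> 72) where
  "X \<^bold>\<and> Y = (\<chi> C. \<Sum>A\<in>Pow C. (- 1) ^ inversions A (C - A) * X $ A * Y $ (C - A))"

definition wedge_list :: "('n canonical_space) list \<Rightarrow> ('n::{finite,linorder}) multivector" where
  "wedge_list vs = foldr (\<lambda>v Y. of_vec v \<^bold>\<and> Y) vs (blade {})"

definition wedge_fam :: "('k::{finite,linorder} \<Rightarrow> 'n canonical_space) \<Rightarrow> ('n::{finite,linorder}) multivector" where
  "wedge_fam v = wedge_list (map v (sorted_list_of_set UNIV))"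

definition grade_inv :: "('n::finite) multivector \<Rightarrow> 'n multivector" where
  "grade_inv X = (\<chi> A. (- 1) ^ card A * X $ A)"

definition reversion :: "('n::finite) multivector \<Rightarrow> 'n multivector" where
  "reversion X = (\<chi> A. (- 1) ^ (card A * (card A - 1) div 2) * X $ A)"

definition lcontr ::
  "('n::{finite,linorder}) multivector \<Rightarrow> 'n multivector \<Rightarrow> 'n multivector" (infixr \<open>\<^bold>\<rfloor>\<close> 72) where
  "X \<^bold>\<rfloor> Y = adjoint (\<lambda>Z. reversion X \<^bold>\<and> Z) Y"

definition outermorphism ::
  "('n canonical_space \<Rightarrow> 'n canonical_space) \<Rightarrow> ('n::{finite,linorder}) multivector \<Rightarrow> 'n multivector" where
  "outermorphism t X =
     (\<Sum>A\<in>UNIV. (X $ A) *\<^sub>R wedge_list (map (\<lambda>\<mu>. t (bvec \<mu>)) (sorted_list_of_set A)))"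


subsection \<open>The defining properties of the exterior algebra\<close>

lemma sum_blade: "(\<Sum>A\<in>UNIV. (X $ A) *\<^sub>R blade A) = (X :: ('n::{finite,linorder}) multivector)"
  using basis_expansion[of X] by (simp add: blade_def scalar_mult_eq_scaleR)

lemma linear_of_vec: "linear of_vec"
  unfolding of_vec_def
  by (rule linearI) (simp_all add: scaleR_add_left sum.distrib scaleR_sum_right)

lemma bilinear_wedge: "bilinear (\<^bold>\<and>)"
  unfolding bilinear_def
  by (auto intro!: linearI
      simp: wedge_def vec_eq_iff algebra_simps sum.distrib sum_distrib_left)

lemma linear_wedge_right: "linear (\<lambda>Y. X \<^bold>\<and> Y)"
  and linear_wedge_left: "linear (\<lambda>X. X \<^bold>\<and> Y)"
  using bilinear_wedge unfolding bilinear_def by blast+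

lemma linear_of_vec_wedge: "linear (\<lambda>v. of_vec v \<^bold>\<and> Y)"
  using linear_compose[OF linear_of_vec linear_wedge_left] by (simp add: o_def)

lemma lcontr_inner: "(X \<^bold>\<rfloor> Y) \<bullet> Z = Y \<bullet> (reversion X \<^bold>\<and> Z)"
  unfolding lcontr_def using adjoint_clauses(2)[OF linear_wedge_right] by metis

lemma of_vec_bvec: "of_vec (bvec i) = blade {i}"
  unfolding of_vec_def bvec_def
  by (simp add: axis_def if_distrib[of "\<lambda>x. x *\<^sub>R _"] cong: if_cong)

lemma blade_wedge_blade:
  fixes A B :: "'n::{finite,linorder} set"
  shows "blade A \<^bold>\<and> blade B =
    (if A \<inter> B = {} then (- 1) ^ inversions A B *\<^sub>R blade (A \<union> B) else 0)"
proof -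
  have "(blade A \<^bold>\<and> blade B) $ C =
      (if A \<inter> B = {} then (- 1) ^ inversions A B *\<^sub>R blade (A \<union> B) else 0) $ C" for C
  proof -
    have "(blade A \<^bold>\<and> blade B) $ C
      = (\<Sum>A'\<in>Pow C. if A' = A then (if C - A = B then (-1) ^ inversions A B else 0) else 0)"
      unfolding wedge_def blade_def axis_def by (simp only: vec_lambda_beta, rule sum.cong) auto
    also have "\<dots> = (if A \<subseteq> C \<and> C - A = B then (-1) ^ inversions A B else 0)"
      by (subst sum.delta) (auto simp: finite)
    also have "\<dots> = (if A \<inter> B = {} then (- 1) ^ inversions A B *\<^sub>R blade (A \<union> B) else 0) $ C"
      by (auto simp: blade_def axis_def)
    finally show ?thesis .
  qed
  then show ?thesis by (simp add: vec_eq_iff)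
qed

lemma inversions_Un_left:
  fixes A B C :: "'n::{finite,linorder} set"
  assumes "A \<inter> B = {}"
  shows "inversions (A \<union> B) C = inversions A C + inversions B C"
proof -
  have "{(i, j). i \<in> A \<union> B \<and> j \<in> C \<and> j < i} =
    {(i, j). i \<in> A \<and> j \<in> C \<and> j < i} \<union> {(i, j). i \<in> B \<and> j \<in> C \<and> j < i}" by auto
  then show ?thesis unfolding inversions_def using assms
    by (simp only:) (rule card_Un_disjoint; auto)
qed

lemma inversions_Un_right:
  fixes A B C :: "'n::{finite,linorder} set"
  assumes "B \<inter> C = {}"
  shows "inversions A (B \<union> C) = inversions A B + inversions A C"
proof -
  have "{(i, j). i \<in> A \<and> j \<in> B \<union> C \<and> j < i} =
    {(i, j). i \<in> A \<and> j \<in> B \<and> j < i} \<union> {(i, j). i \<in> A \<and> j \<in> C \<and> j < i}" by auto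
  then show ?thesis unfolding inversions_def using assms
    by (simp only:) (rule card_Un_disjoint; auto)
qed

lemma wedge_blade_assoc:
  "(blade A \<^bold>\<and> blade B) \<^bold>\<and> blade C = blade A \<^bold>\<and> (blade B \<^bold>\<and> blade C)"
  by (auto simp: blade_wedge_blade linear_cmul[OF linear_wedge_left] linear_cmul[OF linear_wedge_right]
      linear_0[OF linear_wedge_left] linear_0[OF linear_wedge_right]
      inversions_Un_left inversions_Un_right power_add Un_assoc Int_Un_distrib Int_Un_distrib2)

lemma linear_eq_on_blades:
  fixes f h :: "('n::{finite,linorder}) multivector \<Rightarrow> 'b::real_vector"
  assumes "linear f" "linear h" "\<And>A. f (blade A) = h (blade A)"
  shows "f X = h X"
proof -
  have "f (\<Sum>A\<in>UNIV. (X $ A) *\<^sub>R blade A) = h (\<Sum>A\<in>UNIV. (X $ A) *\<^sub>R blade A)"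
    by (simp only: linear_sum[OF assms(1)] linear_sum[OF assms(2)] linear_cmul[OF assms(1)]
      linear_cmul[OF assms(2)] assms(3))
  then show ?thesis by (simp only: sum_blade)
qed

lemma linear_eq_on_bvec:
  fixes f h :: "real ^ 'n \<Rightarrow> 'b::real_vector"
  assumes "linear f" "linear h" "\<And>i. f (bvec i) = h (bvec i)"
  shows "f v = h v"
proof -
  have "(\<Sum>i\<in>UNIV. (v $ i) *\<^sub>R bvec i) = v"
    using basis_expansion[of v] by (simp add: bvec_def scalar_mult_eq_scaleR)
  moreover have "f (\<Sum>i\<in>UNIV. (v $ i) *\<^sub>R bvec i) = h (\<Sum>i\<in>UNIV. (v $ i) *\<^sub>R bvec i)"
    by (simp only: linear_sum[OF assms(1)] linear_sum[OF assms(2)] linear_cmul[OF assms(1)]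
      linear_cmul[OF assms(2)] assms(3))
  ultimately show ?thesis by (simp only:)
qed

lemmas linear_o = linear_compose[unfolded o_def]

lemma wedge_assoc: "(X \<^bold>\<and> Y) \<^bold>\<and> Z = X \<^bold>\<and> (Y \<^bold>\<and> Z)"
proof -
  note L = linear_wedge_left and R = linear_wedge_right
  have 1: "(blade A \<^bold>\<and> blade B) \<^bold>\<and> Z = blade A \<^bold>\<and> (blade B \<^bold>\<and> Z)" for A B
    by (rule linear_eq_on_blades[where f = "\<lambda>Z. (blade A \<^bold>\<and> blade B) \<^bold>\<and> Z"
          and h = "\<lambda>Z. blade A \<^bold>\<and> (blade B \<^bold>\<and> Z)", OF R linear_o[OF R R] wedge_blade_assoc])
  have 2: "(blade A \<^bold>\<and> Y) \<^bold>\<and> Z = blade A \<^bold>\<and> (Y \<^bold>\<and> Z)" for A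
    by (rule linear_eq_on_blades[where f = "\<lambda>Y. (blade A \<^bold>\<and> Y) \<^bold>\<and> Z"
          and h = "\<lambda>Y. blade A \<^bold>\<and> (Y \<^bold>\<and> Z)", OF linear_o[OF R L] linear_o[OF L R] 1])
  show ?thesis
    by (rule linear_eq_on_blades[where f = "\<lambda>X. (X \<^bold>\<and> Y) \<^bold>\<and> Z"
          and h = "\<lambda>X. X \<^bold>\<and> (Y \<^bold>\<and> Z)", OF linear_o[OF L L] L 2])
qed

lemma bvec_wedge_blade:
  "of_vec (bvec i) \<^bold>\<and> blade A =
     (if i \<in> A then 0 else (- 1) ^ inversions {i} A *\<^sub>R blade (insert i A))"
  by (simp add: of_vec_bvec blade_wedge_blade)

lemma bvec_anticommute:
  "of_vec (bvec i) \<^bold>\<and> of_vec (bvec j) = - (of_vec (bvec j) \<^bold>\<and> of_vec (bvec i))"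
proof -
  have "inversions {i} {j} = (if j < i then 1 else 0)" for i j :: "'a::{finite,linorder}"
  proof -
    have "{(a, b). a \<in> {i} \<and> b \<in> {j} \<and> b < a} = (if j < i then {(i, j)} else {})" by auto
    then show ?thesis by (simp only: inversions_def) simp
  qed
  then show ?thesis
    by (cases i j rule: linorder_cases) (auto simp: of_vec_bvec blade_wedge_blade insert_commute)
qed

lemma of_vec_anticommute: "of_vec u \<^bold>\<and> of_vec v = - (of_vec v \<^bold>\<and> of_vec u)"
proof -
  note L = linear_of_vec_wedge and R = linear_o[OF linear_of_vec linear_wedge_right]
  have 1: "of_vec (bvec i) \<^bold>\<and> of_vec v = - (of_vec v \<^bold>\<and> of_vec (bvec i))" for i
    by (rule linear_eq_on_bvec[where f = "\<lambda>v. of_vec (bvec i) \<^bold>\<and> of_vec v"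
          and h = "\<lambda>v. - (of_vec v \<^bold>\<and> of_vec (bvec i))", OF R linear_compose_neg[OF L] bvec_anticommute])
  show ?thesis
    by (rule linear_eq_on_bvec[where f = "\<lambda>u. of_vec u \<^bold>\<and> of_vec v"
          and h = "\<lambda>u. - (of_vec v \<^bold>\<and> of_vec u)", OF L linear_compose_neg[OF R] 1])
qed

lemma of_vec_wedge_self: "of_vec v \<^bold>\<and> of_vec v = 0"
  proof -
  have "2 *\<^sub>R (of_vec v \<^bold>\<and> of_vec v) = 0"
    using of_vec_anticommute[of v v] by (simp add: scaleR_2 eq_neg_iff_add_eq_0)
  then show ?thesis by simp
qed

lemma of_vec_wedge_swap: "of_vec u \<^bold>\<and> (of_vec v \<^bold>\<and> Y) = - (of_vec v \<^bold>\<and> (of_vec u \<^bold>\<and> Y))"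
  using of_vec_anticommute[of u v] wedge_assoc[of "of_vec u" "of_vec v" Y]
    wedge_assoc[of "of_vec v" "of_vec u" Y] linear_neg[OF linear_wedge_left]
  by metis

lemma wedge_list_Cons: "wedge_list (v # vs) = of_vec v \<^bold>\<and> wedge_list vs"
  by (simp add: wedge_list_def)

lemma wedge_list_move: "wedge_list (u # vs @ ws) = (- 1) ^ length vs *\<^sub>R wedge_list (vs @ u # ws)"
proof (induction vs)
  case (Cons v vs)
  then show ?case
    using of_vec_wedge_swap[of u v "wedge_list (vs @ ws)"]
    by (simp add: wedge_list_Cons linear_cmul[OF linear_wedge_right])
qed simp

lemma wedge_list_append_right:
  "wedge_list vs = wedge_list vs' \<Longrightarrow> wedge_list (us @ vs) = wedge_list (us @ vs')"
  by (induction us) (simp_all add: wedge_list_Cons)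

lemma wedge_list_append_0: "wedge_list vs = 0 \<Longrightarrow> wedge_list (us @ vs) = 0"
  by (induction us) (simp_all add: wedge_list_Cons linear_0[OF linear_wedge_right])

lemma wedge_list_repeat: "\<not> distinct vs \<Longrightarrow> wedge_list vs = 0"
proof -
  assume "\<not> distinct vs"
  then obtain us u xs ys where vs: "vs = us @ [u] @ xs @ [u] @ ys"
    using not_distinct_decomp by blast
  have "wedge_list (u # u # ys) = 0"
    by (simp add: wedge_list_Cons wedge_assoc[symmetric] of_vec_wedge_self linear_0[OF linear_wedge_left])
  then have "wedge_list (xs @ u # u # ys) = 0" by (rule wedge_list_append_0)
  then have "wedge_list (u # xs @ u # ys) = 0"
    using wedge_list_move[of u xs "u # ys"] by simp
  then show ?thesis using vs wedge_list_append_0 by simp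
qed

lemma blade_eq_wedge_list:
  "blade A = wedge_list (map bvec (sorted_list_of_set A))" for A :: "'n::{finite,linorder} set"
proof -
  have "sorted xs \<Longrightarrow> distinct xs \<Longrightarrow> wedge_list (map bvec xs) = blade (set xs)" for xs :: "'n list"
  proof (induction xs)
    case (Cons x xs)
    have "{(i, j). i \<in> {x} \<and> j \<in> set xs \<and> j < i} = {}" using Cons.prems by auto
    then have "inversions {x} (set xs) = 0" by (simp only: inversions_def) simp
    then show ?case using Cons by (simp add: wedge_list_Cons bvec_wedge_blade)
  qed (simp add: wedge_list_def)
  then show ?thesis by simp
qed

lemma linear_outermorphism: "linear (outermorphism t)"
  unfolding outermorphism_def
  by (rule linearI) (simp_all add: scaleR_add_left sum.distrib scaleR_sum_right)

lemma outermorphism_blade: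
  "outermorphism t (blade A) = wedge_list (map (\<lambda>i. t (bvec i)) (sorted_list_of_set A))"
  unfolding outermorphism_def blade_def
  by (simp add: axis_def if_distrib[of "\<lambda>x. x *\<^sub>R _"] cong: if_cong)

lemma sorted_split: "sorted xs \<Longrightarrow> xs = filter (\<lambda>j. j < i) xs @ filter (\<lambda>j. \<not> j < i) xs"
  for xs :: "'n::linorder list"
proof (induction xs)
  case (Cons x xs)
  show ?case
  proof (cases "x < i")
    case False
    then have "filter (\<lambda>j. j < i) xs = []" "filter (\<lambda>j. \<not> j < i) xs = xs"
      using Cons.prems by (auto simp: filter_empty_conv filter_id_conv)
    then show ?thesis using False by simp
  qed (use Cons in simp)
qed simp

lemma outermorphism_wedge_list:
  assumes t: "linear t"
  shows "outermorphism t (wedge_list vs) = wedge_list (map t vs)"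
proof (induction vs)
  case Nil
  then show ?case using outermorphism_blade[of t "{}"] by (simp add: wedge_list_def)
next
  case (Cons v vs)
  have b: "outermorphism t (of_vec (bvec i) \<^bold>\<and> blade A) = of_vec (t (bvec i)) \<^bold>\<and> outermorphism t (blade A)" for i A
  proof -
    let ?s = "sorted_list_of_set A" and ?t = "\<lambda>j. t (bvec j)"
    let ?xs = "filter (\<lambda>j. j < i) ?s" and ?ys = "filter (\<lambda>j. \<not> j < i) ?s"
    have sp: "?s = ?xs @ ?ys"
      by (rule sorted_split) simp
    show ?thesis
    proof (cases "i \<in> A")
      case True
      then have "\<not> distinct (map ?t (i # ?s))" by auto
      from wedge_list_repeat[OF this] show ?thesis using True
        by (simp add: bvec_wedge_blade outermorphism_blade wedge_list_Cons linear_0[OF linear_outermorphism])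
    next
      case False
      have "sorted (?xs @ i # ?ys)" using sp[symmetric] sorted_sorted_list_of_set[of A]
        by (auto simp: sorted_append sorted_wrt_filter)
      moreover have "distinct (?xs @ i # ?ys)" "set (?xs @ i # ?ys) = insert i A" using False by auto
      ultimately have ins: "sorted_list_of_set (insert i A) = ?xs @ i # ?ys"
        by (metis sorted_list_of_set.idem_if_sorted_distinct)
      have "{(a, b). a \<in> {i} \<and> b \<in> A \<and> b < a} = Pair i ` set ?xs" by auto
      then have inv: "inversions {i} A = length ?xs"
        unfolding inversions_def by (simp only:) (simp add: card_image inj_on_def distinct_card flip: set_filter)
      have "of_vec (?t i) \<^bold>\<and> wedge_list (map ?t ?s) = wedge_list (?t i # map ?t ?xs @ map ?t ?ys)"
        by (subst sp) (simp add: wedge_list_Cons)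
      then show ?thesis using False wedge_list_move[of "?t i" "map ?t ?xs" "map ?t ?ys"]
        by (simp add: bvec_wedge_blade outermorphism_blade inv ins linear_cmul[OF linear_outermorphism])
    qed
  qed
  have b': "outermorphism t (of_vec (bvec i) \<^bold>\<and> Y) = of_vec (t (bvec i)) \<^bold>\<and> outermorphism t Y" for i Y
    by (rule linear_eq_on_blades[of "\<lambda>Y. outermorphism t (of_vec (bvec i) \<^bold>\<and> Y)"
          "\<lambda>Y. of_vec (t (bvec i)) \<^bold>\<and> outermorphism t Y",
          OF linear_compose[OF linear_wedge_right linear_outermorphism, unfolded o_def]
            linear_compose[OF linear_outermorphism linear_wedge_right, unfolded o_def] b])
  have c: "outermorphism t (of_vec v \<^bold>\<and> Y) = of_vec (t v) \<^bold>\<and> outermorphism t Y" for Y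
    by (rule linear_eq_on_bvec[of "\<lambda>v. outermorphism t (of_vec v \<^bold>\<and> Y)"
          "\<lambda>v. of_vec (t v) \<^bold>\<and> outermorphism t Y",
          OF linear_compose[OF linear_of_vec_wedge linear_outermorphism, unfolded o_def]
            linear_compose[OF t linear_of_vec_wedge, unfolded o_def] b'])
  show ?case by (simp only: wedge_list_Cons list.map c Cons.IH)
qed

lemma wedge_list_linear: "linear (\<lambda>x. wedge_list (us @ x # vs))"
proof (induction us)
  case Nil
  show ?case by (simp add: wedge_list_Cons linear_of_vec_wedge)
next
  case (Cons u us)
  show ?case using linear_o[OF Cons.IH linear_wedge_right] by (simp add: wedge_list_Cons)
qed

lemma wedge_fam_linear: "linear (\<lambda>x. wedge_fam (v(k := x)))"
proof -
  have "k \<in> set (sorted_list_of_set UNIV)" by simp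
  then obtain us vs where s: "sorted_list_of_set UNIV = us @ k # vs" by (meson split_list)
  have "distinct (us @ k # vs)" unfolding s[symmetric] by simp
  then have "map (v(k := x)) (sorted_list_of_set UNIV) = map v us @ x # map v vs" for x
    by (simp add: s)
  then show ?thesis by (simp only: wedge_fam_def wedge_list_linear)
qed

lemma wedge_fam_eq_0: "\<not> inj v \<Longrightarrow> wedge_fam v = 0"
  unfolding wedge_fam_def by (rule wedge_list_repeat) (simp add: distinct_map)

lemma wedge_fam_transpose:
  assumes "i \<noteq> j"
  shows "wedge_fam (v \<circ> Transposition.transpose i j) = - wedge_fam v"
proof -
  define F where "F x y = wedge_fam (v(i := x, j := y))" for x y
  have 0: "F x x = 0" for x unfolding F_def
  proof (rule wedge_fam_eq_0)
    have "(v(i := x, j := x)) i = (v(i := x, j := x)) j" by simp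
    then show "\<not> inj (v(i := x, j := x))" using assms by (metis injD)
  qed
  have r: "F x (y + z) = F x y + F x z" for x y z
    unfolding F_def by (rule linear_add[OF wedge_fam_linear])
  have l: "F (x + y) z = F x z + F y z" for x y z
    unfolding F_def fun_upd_twist[OF assms] by (rule linear_add[OF wedge_fam_linear])
  have "F (v j) (v i) + F (v i) (v j) = 0"
    using 0[of "v i + v j"] unfolding l r by (simp add: 0 add.commute)
  moreover have "v(i := v i, j := v j) = v" by simp
  moreover have "v(i := v j, j := v i) = v \<circ> Transposition.transpose i j"
    using assms by (auto simp: fun_eq_iff Transposition.transpose_def)
  ultimately show ?thesis by (simp add: F_def eq_neg_iff_add_eq_0)
qed

lemma wedge_fam_permute:
  assumes "p permutes (UNIV :: 'k::{finite,linorder} set)"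
  shows "wedge_fam (v \<circ> p) = of_int (sign p) *\<^sub>R wedge_fam v"
  using assms finite
proof (induction arbitrary: v rule: permutes_induct)
  case id
  then show ?case by simp
next
  case (swap a b p)
  have "wedge_fam (v \<circ> Transposition.transpose a b) = (of_int (sign (Transposition.transpose a b)) :: real) *\<^sub>R wedge_fam v"
    by (cases "a = b") (simp_all add: wedge_fam_transpose sign_swap_id)
  moreover have "sign (Transposition.transpose a b \<circ> p) = sign (Transposition.transpose a b) * sign p"
    using swap.hyps by (intro sign_compose permutation_swap_id permutes_imp_permutation[of UNIV]) auto
  moreover have "v \<circ> (Transposition.transpose a b \<circ> p) = (v \<circ> Transposition.transpose a b) \<circ> p"
    by (simp only: o_assoc)
  ultimately show ?case
    using swap.IH[of "v \<circ> Transposition.transpose a b"] by (simp only:) (simp add: mult.commute)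
qed

lemma wedge_fam_bvec:
  assumes "inj (h :: 'k::{finite,linorder} \<Rightarrow> 'n::{finite,linorder})"
  shows "wedge_fam (bvec \<circ> h) = blade (range h) \<or> wedge_fam (bvec \<circ> h) = - blade (range h)"
proof -
  have "distinct xs \<Longrightarrow> wedge_list (map bvec xs) \<in> {blade (set xs), - blade (set xs)}" for xs :: "'n list"
  proof (induction xs)
    case (Cons x xs)
    then have IH: "wedge_list (map bvec xs) \<in> {blade (set xs), - blade (set xs)}" "x \<notin> set xs" by auto
    have "of_vec (bvec x) \<^bold>\<and> blade (set xs) \<in> {blade (insert x (set xs)), - blade (insert x (set xs))}"
      using IH(2) by (cases "even (inversions {x} (set xs))") (auto simp: bvec_wedge_blade)
    then show ?case using IH(1) by (auto simp: wedge_list_Cons linear_neg[OF linear_wedge_right])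
  qed (simp add: wedge_list_def)
  from this[of "map h (sorted_list_of_set UNIV)"] show ?thesis
    using assms by (auto simp: wedge_fam_def distinct_map)
qed

lemma multilinear_eq_on_bvec:
  fixes F G :: "('k::finite \<Rightarrow> real ^ 'n) \<Rightarrow> real"
  assumes F: "\<And>v k. linear (\<lambda>x. F (v(k := x)))" and G: "\<And>v k. linear (\<lambda>x. G (v(k := x)))"
    and eq: "\<And>h. F (bvec \<circ> h) = G (bvec \<circ> h)"
  shows "F v = G v"
proof -
  have "\<forall>i. i \<notin> S \<longrightarrow> v i \<in> range bvec \<Longrightarrow> F v = G v" if "finite S" for S v
    using that
  proof (induction S arbitrary: v)
    case empty
    then have "\<forall>i. \<exists>j. v i = bvec j" by auto
    then obtain h where "\<forall>i. v i = bvec (h i)" by metis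
    then have "v = bvec \<circ> h" by auto
    then show ?case using eq by (simp only:)
  next
    case (insert k S)
    have "F (v(k := bvec j)) = G (v(k := bvec j))" for j
      by (rule insert.IH) (use insert.prems in auto)
    from linear_eq_on_bvec[OF F G this, of "v k"] show ?case by simp
  qed
  from this[of UNIV] show ?thesis by simp
qed

text \<open>The inner product of coordinates is the Gram determinant scalar product.\<close>

theorem inner_wedge_fam:
  fixes v w :: "'k::{finite,linorder} \<Rightarrow> ('n::{finite,linorder}) canonical_space"
  shows "wedge_fam v \<bullet> wedge_fam w = det (\<chi> i j. v i \<bullet> w j)"
proof -
  define D where "D v w = det (\<chi> i j. v i \<bullet> w j)" for v w :: "'k \<Rightarrow> 'n canonical_space"
  have D_sym: "D v w = D w v" for v w
    unfolding D_def by (subst det_transpose[symmetric]) (simp add: Finite_Cartesian_Product.transpose_def inner_commute)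
  have D_row: "D (v(k := x)) w = det (\<chi> i. if i = k then (\<chi> j. x \<bullet> w j) else (\<chi> j. v i \<bullet> w j))" for v w k x
    unfolding D_def by (rule arg_cong[of _ _ det]) (simp add: vec_eq_iff)
  have D_lin: "linear (\<lambda>x. D (v(k := x)) w)" for v w k
  proof (rule linearI)
    show "D (v(k := x + y)) w = D (v(k := x)) w + D (v(k := y)) w" for x y
    proof -
      have "(\<chi> j. (x + y) \<bullet> w j) = (\<chi> j. x \<bullet> w j) + (\<chi> j. y \<bullet> w j)"
        by (simp add: vec_eq_iff inner_add_left)
      then show ?thesis by (simp only: D_row det_row_add)
    qed
    show "D (v(k := r *\<^sub>R x)) w = r *\<^sub>R D (v(k := x)) w" for r x
    proof -
      have "(\<chi> j. (r *\<^sub>R x) \<bullet> w j) = r *s (\<chi> j. x \<bullet> w j)"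
        by (simp add: vec_eq_iff)
      then show ?thesis by (simp only: D_row det_row_mul real_scaleR_def)
    qed
  qed
  have W_lin: "linear (\<lambda>x. wedge_fam (v(k := x)) \<bullet> W)" for v :: "'k \<Rightarrow> 'n canonical_space" and k W
    by (rule linear_o[OF wedge_fam_linear]) (simp add: linear_iff inner_add_left)
  have D_0: "D v w = 0" if "\<not> inj v" for v w
  proof -
    from that obtain i j where "i \<noteq> j" "v i = v j" by (auto simp: inj_def)
    then show ?thesis unfolding D_def by (intro det_identical_rows[of i j]) (simp_all add: row_def)
  qed
  have basis: "wedge_fam (bvec \<circ> f) \<bullet> wedge_fam (bvec \<circ> h) = D (bvec \<circ> f) (bvec \<circ> h)"
    for f h :: "'k \<Rightarrow> 'n"
  proof (cases "inj f \<and> inj h")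
    case False
    have *: "\<not> inj (bvec \<circ> f)" if "\<not> inj f" for f :: "'k \<Rightarrow> 'n"
      using that inj_on_imageI2 by blast
    show ?thesis using False *[of f] *[of h]
      by (metis D_0 D_sym wedge_fam_eq_0 inner_zero_left inner_zero_right)
  next
    case True
    show ?thesis
    proof (cases "range f = range h")
      case False
      have "blade (range f) \<bullet> blade (range h) = 0"
        using False by (simp add: blade_def inner_axis_axis)
      then have L: "wedge_fam (bvec \<circ> f) \<bullet> wedge_fam (bvec \<circ> h) = 0"
        using wedge_fam_bvec[of f] wedge_fam_bvec[of h] True by auto
      have "card (range f) = card (range h)" using True by (simp add: card_image)
      then have "\<not> range f \<subseteq> range h" using False card_subset_eq[of "range h" "range f"] by auto
      then obtain i where "f i \<notin> range h" by auto
      then have "row i (\<chi> i j. (bvec \<circ> f) i \<bullet> (bvec \<circ> h) j) = 0"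
        by (auto simp: row_def vec_eq_iff bvec_def inner_axis_axis)
      then show ?thesis using L unfolding D_def by (simp only: det_zero_row)
    next
      case rng: True
      define p where "p = inv h \<circ> f"
      have "h (p x) = f x" for x
        unfolding p_def o_def by (rule f_inv_into_f) (simp flip: rng)
      then have f: "f = h \<circ> p" by (simp add: fun_eq_iff)
      have "inj p" using True f inj_on_imageI2 by blast
      then have "p permutes UNIV" 
        by (intro bij_imp_permutes) (auto simp: bij_def finite_UNIV_inj_surj)
      have 1: "wedge_fam (bvec \<circ> h) \<bullet> wedge_fam (bvec \<circ> h) = 1"
        using wedge_fam_bvec[of h] True by (auto simp: blade_def inner_axis_axis)
      have "D (bvec \<circ> f) (bvec \<circ> h) = det (\<chi> i. (mat 1 :: ((real, 'k) vec, 'k) vec) $ p i)"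
        unfolding D_def using True
        by (intro arg_cong[of _ _ det])
          (auto simp: f vec_eq_iff bvec_def inner_axis_axis mat_def inj_eq)
      also have "\<dots> = of_int (sign p)"
        using det_permute_rows[OF \<open>p permutes UNIV\<close>, of "mat 1 :: ((real, 'k) vec, 'k) vec"] by simp
      finally show ?thesis
        using wedge_fam_permute[OF \<open>p permutes UNIV\<close>, of "bvec \<circ> h"] 1
        by (simp add: f o_assoc)
    qed
  qed
  have 1: "wedge_fam v \<bullet> wedge_fam (bvec \<circ> h) = D v (bvec \<circ> h)" for v h
    by (rule multilinear_eq_on_bvec[OF W_lin D_lin basis])
  have "wedge_fam w \<bullet> wedge_fam v = D w v"
    by (rule multilinear_eq_on_bvec[OF W_lin D_lin])
      (simp only: inner_commute[of _ "wedge_fam v"] D_sym[of _ v] 1)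
  then show ?thesis using D_sym by (simp add: inner_commute D_def)
qed


section \<open>Fields and their derivatives\<close>

text \<open>Fields are total functions on the manifold type; only their values on \<open>U\<close> matter.\<close>

definition smooth_field ::
  "('m, 'n::finite) chart \<Rightarrow> 'm set \<Rightarrow> ('m \<Rightarrow> 'b::real_normed_vector) \<Rightarrow> bool" where
  "smooth_field c U X \<longleftrightarrow> smooth_on (snd c ` U) (X \<circ> chart_inv c)"

definition \<M> :: "('m, 'n) chart \<Rightarrow> 'm set \<Rightarrow> ('m \<Rightarrow> ('n::{finite,linorder}) multivector) set" where
  "\<M> c U = {X. smooth_field c U X}"

definition pd ::
  "('m, 'n::finite) chart \<Rightarrow> 'n \<Rightarrow> ('m \<Rightarrow> 'b::real_normed_vector) \<Rightarrow> 'm \<Rightarrow> 'b" where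
  "pd c \<mu> X p = frechet_derivative (X \<circ> chart_inv c) (at (snd c p)) (bvec \<mu>)"

definition ddir ::
  "('m, 'n::finite) chart \<Rightarrow> 'n canonical_space \<Rightarrow> ('m \<Rightarrow> 'b::real_normed_vector) \<Rightarrow> 'm \<Rightarrow> 'b" where
  "ddir c a X p = (\<Sum>\<mu>\<in>UNIV. (a \<bullet> bvec \<mu>) *\<^sub>R pd c \<mu> X p)"

definition ddir_endo ::
  "('m, 'n::finite) chart \<Rightarrow> 'n canonical_space \<Rightarrow> ('m \<Rightarrow> 'n canonical_space \<Rightarrow> 'n canonical_space)
     \<Rightarrow> ('m \<Rightarrow> 'n canonical_space) \<Rightarrow> 'm \<Rightarrow> 'n canonical_space" where
  "ddir_endo c a g b p = ddir c a (\<lambda>q. g q (b q)) p - g p (ddir c a b p)"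

definition canonical_div ::
  "('m, 'n) chart \<Rightarrow> ('m \<Rightarrow> ('n::{finite,linorder}) multivector) \<Rightarrow> 'm \<Rightarrow> 'n multivector" where
  "canonical_div c X p = (\<Sum>\<mu>\<in>UNIV. of_vec (bvec \<mu>) \<^bold>\<rfloor> pd c \<mu> X p)"

definition canonical_curl ::
  "('m, 'n) chart \<Rightarrow> ('m \<Rightarrow> ('n::{finite,linorder}) multivector) \<Rightarrow> 'm \<Rightarrow> 'n multivector" where
  "canonical_curl c X p = (\<Sum>\<mu>\<in>UNIV. of_vec (bvec \<mu>) \<^bold>\<and> pd c \<mu> X p)"


section \<open>Metric structures and Levi-Civita derivatives\<close>

type_synonym ('m, 'n) endo_field = "'m \<Rightarrow> 'n canonical_space \<Rightarrow> 'n canonical_space"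

definition metric_structure ::
  "('m::topological_space, 'n::finite) chart \<Rightarrow> 'm set \<Rightarrow> ('m, 'n) endo_field \<Rightarrow> bool" where
  "metric_structure c U g \<longleftrightarrow>
     open U \<and> U \<subseteq> fst c \<and>
     (\<forall>p\<in>U. linear (g p)) \<and>
     (\<forall>v. smooth_field c U (\<lambda>p. g p v)) \<and>
     (\<forall>p\<in>U. g p = adjoint (g p)) \<and>
     (\<forall>p\<in>U. det (matrix (g p)) \<noteq> 0)"

definition gcross ::
  "('n canonical_space \<Rightarrow> 'n canonical_space) \<Rightarrow> ('n::{finite,linorder}) multivector \<Rightarrow> 'n canonical_space \<Rightarrow> 'n multivector" where
  "gcross h B b = - (of_vec (h b) \<^bold>\<rfloor> B)"

definition omega0 ::
  "('m, 'n) chart \<Rightarrow> ('m, 'n) endo_field \<Rightarrow> 'n canonical_space \<Rightarrow> 'm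
     \<Rightarrow> ('n::{finite,linorder}) multivector" where
  "omega0 c g a p =
     - (1/4) *\<^sub>R (\<Sum>\<mu>\<in>UNIV. \<Sum>\<nu>\<in>UNIV.
        (a \<bullet> (ddir_endo c (bvec \<mu>) g (\<lambda>_. bvec \<nu>) p - ddir_endo c (bvec \<nu>) g (\<lambda>_. bvec \<mu>) p)) *\<^sub>R
        (of_vec (inv (g p) (bvec \<mu>)) \<^bold>\<and> of_vec (inv (g p) (bvec \<nu>))))"

text \<open>The vector \<open>\<lambda>\<^sub>a(b)\<close>, as a grade one multivector.\<close>

definition levi_civita ::
  "('m, 'n) chart \<Rightarrow> ('m, 'n) endo_field \<Rightarrow> 'n canonical_space \<Rightarrow> 'm \<Rightarrow> 'n canonical_space
     \<Rightarrow> ('n::{finite,linorder}) multivector" where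
  "levi_civita c g a p b =
     of_vec ((1/2) *\<^sub>R inv (g p) (ddir_endo c a g (\<lambda>_. b) p)) + gcross (g p) (omega0 c g a p) b"

definition Lambda ::
  "('m, 'n) chart \<Rightarrow> ('m, 'n) endo_field \<Rightarrow> 'n canonical_space \<Rightarrow> 'm
     \<Rightarrow> ('n::{finite,linorder}) multivector \<Rightarrow> 'n multivector" where
  "Lambda c g a p X = (\<Sum>\<mu>\<in>UNIV. levi_civita c g a p (bvec \<mu>) \<^bold>\<and> (of_vec (bvec \<mu>) \<^bold>\<rfloor> X))"

definition Dplus ::
  "('m, 'n) chart \<Rightarrow> ('m, 'n) endo_field \<Rightarrow> 'n canonical_space
     \<Rightarrow> ('m \<Rightarrow> ('n::{finite,linorder}) multivector) \<Rightarrow> 'm \<Rightarrow> 'n multivector" where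
  "Dplus c g a X p = ddir c a X p + Lambda c g a p (X p)"

definition Dminus ::
  "('m, 'n) chart \<Rightarrow> ('m, 'n) endo_field \<Rightarrow> 'n canonical_space
     \<Rightarrow> ('m \<Rightarrow> ('n::{finite,linorder}) multivector) \<Rightarrow> 'm \<Rightarrow> 'n multivector" where
  "Dminus c g a X p = ddir c a X p - adjoint (Lambda c g a p) (X p)"

definition Dplus_div ::
  "('m, 'n) chart \<Rightarrow> ('m, 'n) endo_field
     \<Rightarrow> ('m \<Rightarrow> ('n::{finite,linorder}) multivector) \<Rightarrow> 'm \<Rightarrow> 'n multivector" where
  "Dplus_div c g X p = (\<Sum>\<mu>\<in>UNIV. of_vec (bvec \<mu>) \<^bold>\<rfloor> Dplus c g (bvec \<mu>) X p)"

definition Dminus_div ::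
  "('m, 'n) chart \<Rightarrow> ('m, 'n) endo_field
     \<Rightarrow> ('m \<Rightarrow> ('n::{finite,linorder}) multivector) \<Rightarrow> 'm \<Rightarrow> 'n multivector" where
  "Dminus_div c g X p =
     (\<Sum>\<mu>\<in>UNIV. of_vec (inv (g p) (bvec \<mu>)) \<^bold>\<rfloor> Dminus c g (bvec \<mu>) X p)"

definition metric_density :: "('m, 'n::finite) endo_field \<Rightarrow> 'm \<Rightarrow> real" where
  "metric_density g p = sqrt \<bar>det (matrix (g p))\<bar>"


section \<open>The metric Hodge coderivative\<close>

definition frame_field ::
  "('m, 'n::finite) chart \<Rightarrow> 'm set \<Rightarrow> ('n \<Rightarrow> 'm \<Rightarrow> 'n canonical_space) \<Rightarrow> bool" where
  "frame_field c U e \<longleftrightarrow>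
     (\<forall>\<mu>. smooth_field c U (e \<mu>)) \<and>
     (\<forall>p\<in>U. inj (\<lambda>\<mu>. e \<mu> p) \<and> independent (range (\<lambda>\<mu>. e \<mu> p)))"

definition reciprocal_frame_fields ::
  "('m, 'n::finite) chart \<Rightarrow> 'm set
     \<Rightarrow> ('n \<Rightarrow> 'm \<Rightarrow> 'n canonical_space) \<Rightarrow> ('n \<Rightarrow> 'm \<Rightarrow> 'n canonical_space) \<Rightarrow> bool" where
  "reciprocal_frame_fields c U e e' \<longleftrightarrow>
     frame_field c U e \<and> frame_field c U e' \<and>
     (\<forall>p\<in>U. \<forall>\<mu> \<nu>. e \<mu> p \<bullet> e' \<nu> p = (if \<mu> = \<nu> then 1 else 0))"

definition volume_element ::
  "('n \<Rightarrow> 'm \<Rightarrow> 'n canonical_space) \<Rightarrow> ('n \<Rightarrow> 'm \<Rightarrow> 'n canonical_space) \<Rightarrow> 'm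
     \<Rightarrow> ('n::{finite,linorder}) multivector" where
  "volume_element e e' p =
     sqrt (wedge_fam (\<lambda>\<mu>. e \<mu> p) \<bullet> wedge_fam (\<lambda>\<mu>. e \<mu> p)) *\<^sub>R wedge_fam (\<lambda>\<mu>. e' \<mu> p)"

definition hodge_star ::
  "('m, 'n) endo_field \<Rightarrow> ('m \<Rightarrow> 'n multivector) \<Rightarrow> 'm
     \<Rightarrow> ('n::{finite,linorder}) multivector \<Rightarrow> 'n multivector" where
  "hodge_star g \<tau> p X =
     metric_density g p *\<^sub>R (outermorphism (inv (g p)) (reversion X) \<^bold>\<rfloor> \<tau> p)"

definition hodge_coderivative ::
  "('m, 'n) chart \<Rightarrow> ('m, 'n) endo_field \<Rightarrow> ('m \<Rightarrow> 'n multivector)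
     \<Rightarrow> ('m \<Rightarrow> ('n::{finite,linorder}) multivector) \<Rightarrow> 'm \<Rightarrow> 'n multivector" where
  "hodge_coderivative c g \<tau> X p =
     inv (hodge_star g \<tau> p) (canonical_curl c (\<lambda>q. hodge_star g \<tau> q (grade_inv (X q))) p)"

end

(*
  Fix a point, write H for the inverse of g, and Der(s) for the derivation of the exterior algebra
  that extends the endomorphism s; the term with omega_0 makes lambda_a the usual Christoffel
  endomorphism, so that Lambda_a = Der(lambda_a).

  The derivative of the outermorphism of a field t is Der((a.d t) t^-1) composed with it. For t = H,
  conjugation by g turns D+ into a.d + Der(- (a.d g) H + g lambda_a H), and metric compatibility
  identifies the endomorphism with minus the adjoint of lambda_a. This is the first identity.

  Contraction with b_mu is an antiderivation and lambda_a(b) is symmetric in a and b. As contractions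
  anticommute, the sum over mu of b_mu contracted with Lambda_mu(Y) reduces to the contraction of Y
  with the covector trace(lambda_mu). Jacobi's formula, which is the derivative of the outermorphism
  evaluated at the pseudoscalar, says that this covector is the logarithmic differential of
  sqrt |det g|. This is the second identity.

  For the third, tau is a locally constant sign times the pseudoscalar, and contracting a
  wedge product with b_mu shows that the dual exchanges b_mu wedge and (minus) contraction by b_mu.
*)
theory Submission
  imports Defs
begin

section \<open>Contractions by vectors\<close>

lemma inner_bvec: "v \<bullet> bvec i = v $ i" "bvec i \<bullet> v = v $ i"
  by (simp_all add: bvec_def inner_axis inner_commute)

lemma bvec_nth: "bvec i $ j = (if i = j then 1 else 0)"
  by (simp add: bvec_def axis_def)

lemma sum_bvec: "(\<Sum>i\<in>UNIV. (v $ i) *\<^sub>R bvec i) = v"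
  using basis_expansion[of v] by (simp add: bvec_def scalar_mult_eq_scaleR)

text \<open>Every blade is a wedge product of vectors, so linear maps can be compared by induction
  on the number of vector factors, without counting \<open>inversions\<close>.\<close>

lemma multivector_eqI:
  fixes f h :: "('n::{finite,linorder}) multivector \<Rightarrow> 'b::real_vector"
  assumes "linear f" "linear h" "f (blade {}) = h (blade {})"
    and "\<And>v Y. f Y = h Y \<Longrightarrow> f (of_vec v \<^bold>\<and> Y) = h (of_vec v \<^bold>\<and> Y)"
  shows "f X = h X"
proof (rule linear_eq_on_blades[OF assms(1,2)])
  have "f (wedge_list vs) = h (wedge_list vs)" for vs
    by (induction vs) (simp_all add: wedge_list_Cons assms(4), simp add: wedge_list_def assms(3))
  then show "f (blade A) = h (blade A)" for A by (simp add: blade_eq_wedge_list)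
qed

lemma linear_reversion: "linear reversion"
  unfolding reversion_def by (rule linearI) (simp_all add: vec_eq_iff algebra_simps)

lemma linear_grade_inv: "linear grade_inv"
  unfolding grade_inv_def by (rule linearI) (simp_all add: vec_eq_iff algebra_simps)

lemma reversion_of_vec [simp]: "reversion (of_vec v) = of_vec (v :: ('n::{finite,linorder}) canonical_space)"
proof (rule linear_eq_on_bvec[OF linear_o[OF linear_of_vec linear_reversion] linear_of_vec])
  show "reversion (of_vec (bvec i)) = of_vec (bvec i)" for i :: 'n
    by (auto simp: of_vec_bvec blade_def reversion_def vec_eq_iff axis_def)
qed

text \<open>Reversion fixes vectors, so contraction by a vector is adjoint to left multiplication by
  the same vector.\<close>

lemma of_vec_lcontr_inner: "(of_vec u \<^bold>\<rfloor> Y) \<bullet> Z = Y \<bullet> (of_vec u \<^bold>\<and> Z)"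
  by (simp add: lcontr_inner)

lemma linear_lcontr: "linear (\<lambda>Y. X \<^bold>\<rfloor> Y)"
  unfolding lcontr_def by (rule adjoint_linear[OF linear_wedge_right])

lemma inner_eqI: "(\<And>z. x \<bullet> z = y \<bullet> z) \<Longrightarrow> x = y"
  for x y :: "'a::real_inner"
  using vector_eq_rdot[of x y] by simp

lemma linear_lcontr_left: "linear (\<lambda>X. X \<^bold>\<rfloor> Y)"
  by (rule linearI; rule inner_eqI)
    (simp_all add: lcontr_inner linear_add[OF linear_reversion] linear_cmul[OF linear_reversion]
      linear_add[OF linear_wedge_left] linear_cmul[OF linear_wedge_left] inner_add)

lemma linear_of_vec_lcontr: "linear (\<lambda>v. of_vec v \<^bold>\<rfloor> Y)"
  by (rule linear_o[OF linear_of_vec linear_lcontr_left])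

text \<open>By adjointness the sign for removing \<open>i\<close> from \<open>A\<close> is the sign
  for inserting \<open>i\<close> into \<open>A - {i}\<close>.\<close>

lemma bvec_lcontr_blade:
  "of_vec (bvec i) \<^bold>\<rfloor> blade A =
     (if i \<in> A then (- 1) ^ inversions {i} (A - {i}) *\<^sub>R blade (A - {i}) else 0)"
proof (rule inner_eqI)
  fix Z
  have "(of_vec (bvec i) \<^bold>\<rfloor> blade A) \<bullet> blade C =
     (if i \<in> A then (- 1) ^ inversions {i} (A - {i}) *\<^sub>R blade (A - {i}) else 0) \<bullet> blade C" for C
    by (auto simp: of_vec_lcontr_inner bvec_wedge_blade) (auto simp: blade_def inner_axis_axis)
  then show "(of_vec (bvec i) \<^bold>\<rfloor> blade A) \<bullet> Z =
     (if i \<in> A then (- 1) ^ inversions {i} (A - {i}) *\<^sub>R blade (A - {i}) else 0) \<bullet> Z"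
    by (rule linear_eq_on_blades[OF bounded_linear.linear[OF bounded_linear_inner_right]
        bounded_linear.linear[OF bounded_linear_inner_right]])
qed

lemma bvec_lcontr_bvec_wedge_blade:
  "of_vec (bvec i) \<^bold>\<rfloor> (of_vec (bvec j) \<^bold>\<and> blade A) =
     (bvec i \<bullet> bvec j) *\<^sub>R blade A - of_vec (bvec j) \<^bold>\<and> (of_vec (bvec i) \<^bold>\<rfloor> blade A)"
proof -
  note lin = linear_cmul[OF linear_lcontr] linear_0[OF linear_lcontr]
    linear_cmul[OF linear_wedge_right] linear_0[OF linear_wedge_right]
  have neq: ?thesis if "i \<noteq> j"
  \<comment> \<open>For distinct indices both sides vanish outside this case.\<close>
  proof (cases "i \<in> A \<and> j \<notin> A")
    case True
    \<comment> \<open>Exactly one of the two orders of \<open>i\<close> and \<open>j\<close> is an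
      inversion; this extra factor is the minus sign of the rule.\<close>
    have swap: "inversions {i} {j} + inversions {j} {i} = 1"
    proof -
      have "{(a, b). a \<in> {k} \<and> b \<in> {l} \<and> b < a} = (if l < k then {(k, l)} else {})" for k l :: 'a
        by auto
      then show ?thesis using that by (simp only: inversions_def) auto
    qed
    have "inversions {j} A = inversions {j} (A - {i}) + inversions {j} {i}"
      using inversions_Un_right[of "A - {i}" "{i}" "{j}"] True by (simp add: insert_absorb)
    moreover have "inversions {i} (insert j (A - {i})) = inversions {i} (A - {i}) + inversions {i} {j}"
      using inversions_Un_right[of "A - {i}" "{j}" "{i}"] True by simp
    moreover have "insert j A - {i} = insert j (A - {i})" using that by auto
    ultimately have "(-1::real) ^ inversions {j} A * (-1) ^ inversions {i} (insert j A - {i})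
        = (-1) ^ (inversions {j} (A - {i}) + inversions {i} (A - {i})
           + (inversions {i} {j} + inversions {j} {i}))"
      by (simp add: power_add)
    then show ?thesis
      using True that \<open>insert j A - {i} = _\<close>
      by (simp add: swap bvec_wedge_blade bvec_lcontr_blade lin inner_bvec bvec_nth power_add mult.commute)
  qed (use that in \<open>auto simp: bvec_wedge_blade bvec_lcontr_blade lin inner_bvec bvec_nth\<close>)
  have eq: ?thesis if "i = j"
    using that
    by (auto simp: bvec_wedge_blade bvec_lcontr_blade lin inner_bvec bvec_nth insert_absorb simp flip: power_add)
  show ?thesis using eq neq by blast
qed

text \<open>Contraction by a vector is an antiderivation: the rule spreads by linearity from blades
  and basis vectors to all \<open>Y\<close>, then all \<open>v\<close>, then all
  \<open>u\<close>.\<close>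

lemma of_vec_lcontr_of_vec_wedge:
  "of_vec u \<^bold>\<rfloor> (of_vec v \<^bold>\<and> Y) = (u \<bullet> v) *\<^sub>R Y - of_vec v \<^bold>\<and> (of_vec u \<^bold>\<rfloor> Y)"
proof -
  note L = linear_of_vec_lcontr linear_of_vec_wedge linear_lcontr linear_wedge_right
  note lin = L[THEN linear_add] L[THEN linear_cmul]
  have 1: "of_vec (bvec i) \<^bold>\<rfloor> (of_vec (bvec j) \<^bold>\<and> Y) =
     (bvec i \<bullet> bvec j) *\<^sub>R Y - of_vec (bvec j) \<^bold>\<and> (of_vec (bvec i) \<^bold>\<rfloor> Y)" for i j
    by (rule linear_eq_on_blades[of "\<lambda>Y. of_vec (bvec i) \<^bold>\<rfloor> (of_vec (bvec j) \<^bold>\<and> Y)"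
        "\<lambda>Y. (bvec i \<bullet> bvec j) *\<^sub>R Y - of_vec (bvec j) \<^bold>\<and> (of_vec (bvec i) \<^bold>\<rfloor> Y)"])
      (auto intro!: linearI simp: lin algebra_simps bvec_lcontr_bvec_wedge_blade)
  have 2: "of_vec (bvec i) \<^bold>\<rfloor> (of_vec v \<^bold>\<and> Y) =
     (bvec i \<bullet> v) *\<^sub>R Y - of_vec v \<^bold>\<and> (of_vec (bvec i) \<^bold>\<rfloor> Y)" for i v
    by (rule linear_eq_on_bvec[of "\<lambda>v. of_vec (bvec i) \<^bold>\<rfloor> (of_vec v \<^bold>\<and> Y)"
        "\<lambda>v. (bvec i \<bullet> v) *\<^sub>R Y - of_vec v \<^bold>\<and> (of_vec (bvec i) \<^bold>\<rfloor> Y)"])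
      (auto intro!: linearI simp: lin algebra_simps 1 inner_add)
  show ?thesis
    by (rule linear_eq_on_bvec[of "\<lambda>u. of_vec u \<^bold>\<rfloor> (of_vec v \<^bold>\<and> Y)"
        "\<lambda>u. (u \<bullet> v) *\<^sub>R Y - of_vec v \<^bold>\<and> (of_vec u \<^bold>\<rfloor> Y)"])
      (auto intro!: linearI simp: lin algebra_simps 2 inner_add)
qed

lemma of_vec_lcontr_one [simp]: "of_vec u \<^bold>\<rfloor> blade {} = 0"
  using linear_eq_on_bvec[OF linear_of_vec_lcontr linear_zero, of "blade {}"]
  by (simp add: bvec_lcontr_blade)

lemma wedge_one_left [simp]: "blade {} \<^bold>\<and> Y = Y"
  using linear_eq_on_blades[OF linear_wedge_right linear_ident, of "blade {}"]
  by (simp add: blade_wedge_blade inversions_def)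

lemma wedge_one_right [simp]: "Y \<^bold>\<and> blade {} = Y"
  using linear_eq_on_blades[OF linear_wedge_left linear_ident, of "blade {}"]
  by (simp add: blade_wedge_blade inversions_def)

lemma of_vec_lcontr_of_vec: "of_vec u \<^bold>\<rfloor> of_vec v = (u \<bullet> v) *\<^sub>R blade {}"
  using of_vec_lcontr_of_vec_wedge[of u v "blade {}"] by (simp add: linear_0[OF linear_wedge_right])

lemma of_vec_lcontr_swap: "of_vec u \<^bold>\<rfloor> (of_vec v \<^bold>\<rfloor> Y) = - (of_vec v \<^bold>\<rfloor> (of_vec u \<^bold>\<rfloor> Y))"
  by (rule inner_eqI) (simp add: of_vec_lcontr_inner of_vec_wedge_swap[of u v])

section \<open>Grade involution and the graded Leibniz rule for contractions\<close>

lemma grade_inv_one [simp]: "grade_inv (blade {}) = blade {}"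
  by (auto simp: grade_inv_def blade_def vec_eq_iff axis_def)

lemma grade_inv_blade: "grade_inv (blade A) = (- 1) ^ card A *\<^sub>R blade A"
  by (auto simp: grade_inv_def blade_def vec_eq_iff axis_def)

lemma grade_inv_of_vec_wedge: "grade_inv (of_vec v \<^bold>\<and> Y) = - (of_vec v \<^bold>\<and> grade_inv Y)"
proof -
  note L = linear_of_vec_wedge linear_wedge_right linear_grade_inv
  note lin = L[THEN linear_add] L[THEN linear_cmul] linear_0[OF linear_grade_inv]
  have 1: "grade_inv (of_vec (bvec i) \<^bold>\<and> Y) = - (of_vec (bvec i) \<^bold>\<and> grade_inv Y)" for i
    by (rule linear_eq_on_blades[of "\<lambda>Y. grade_inv (of_vec (bvec i) \<^bold>\<and> Y)"
         "\<lambda>Y. - (of_vec (bvec i) \<^bold>\<and> grade_inv Y)"])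
      (auto intro!: linearI simp: lin algebra_simps grade_inv_blade bvec_wedge_blade)
  show ?thesis
    by (rule linear_eq_on_bvec[of "\<lambda>v. grade_inv (of_vec v \<^bold>\<and> Y)"
         "\<lambda>v. - (of_vec v \<^bold>\<and> grade_inv Y)"])
      (auto intro!: linearI simp: lin algebra_simps 1)
qed

text \<open>Induction over the vector factors of \<open>Y\<close>: each factor that the contraction
  passes costs a sign, and \<open>grade_inv\<close> collects these signs.\<close>

lemma of_vec_lcontr_wedge:
  "of_vec u \<^bold>\<rfloor> (Y \<^bold>\<and> Z) = (of_vec u \<^bold>\<rfloor> Y) \<^bold>\<and> Z + grade_inv Y \<^bold>\<and> (of_vec u \<^bold>\<rfloor> Z)"
proof (rule multivector_eqI[of "\<lambda>Y. of_vec u \<^bold>\<rfloor> (Y \<^bold>\<and> Z)"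
    "\<lambda>Y. (of_vec u \<^bold>\<rfloor> Y) \<^bold>\<and> Z + grade_inv Y \<^bold>\<and> (of_vec u \<^bold>\<rfloor> Z)"])
  note L = linear_wedge_left linear_wedge_right linear_grade_inv linear_lcontr
  note lin = L[THEN linear_add] L[THEN linear_cmul] L[THEN linear_0] L[THEN linear_neg] L[THEN linear_diff]
  show "linear (\<lambda>Y. of_vec u \<^bold>\<rfloor> (Y \<^bold>\<and> Z))"
    "linear (\<lambda>Y. (of_vec u \<^bold>\<rfloor> Y) \<^bold>\<and> Z + grade_inv Y \<^bold>\<and> (of_vec u \<^bold>\<rfloor> Z))"
    by (auto intro!: linearI simp: lin algebra_simps)
  show "of_vec u \<^bold>\<rfloor> (blade {} \<^bold>\<and> Z) =
      (of_vec u \<^bold>\<rfloor> blade {}) \<^bold>\<and> Z + grade_inv (blade {}) \<^bold>\<and> (of_vec u \<^bold>\<rfloor> Z)"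
    by (simp add: lin)
  show "of_vec u \<^bold>\<rfloor> ((of_vec v \<^bold>\<and> Y) \<^bold>\<and> Z) =
      (of_vec u \<^bold>\<rfloor> (of_vec v \<^bold>\<and> Y)) \<^bold>\<and> Z + grade_inv (of_vec v \<^bold>\<and> Y) \<^bold>\<and> (of_vec u \<^bold>\<rfloor> Z)"
    if "of_vec u \<^bold>\<rfloor> (Y \<^bold>\<and> Z) = (of_vec u \<^bold>\<rfloor> Y) \<^bold>\<and> Z + grade_inv Y \<^bold>\<and> (of_vec u \<^bold>\<rfloor> Z)" for v Y
    by (simp add: wedge_assoc of_vec_lcontr_of_vec_wedge grade_inv_of_vec_wedge that lin)
qed


section \<open>Outermorphisms\<close>

lemma outermorphism_one [simp]: "outermorphism t (blade {}) = blade {}"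
  by (simp add: outermorphism_blade wedge_list_def)

lemma outermorphism_of_vec_wedge:
  assumes "linear t"
  shows "outermorphism t (of_vec v \<^bold>\<and> Y) = of_vec (t v) \<^bold>\<and> outermorphism t Y"
proof (rule linear_eq_on_blades[of "\<lambda>Y. outermorphism t (of_vec v \<^bold>\<and> Y)"
      "\<lambda>Y. of_vec (t v) \<^bold>\<and> outermorphism t Y",
      OF linear_o[OF linear_wedge_right linear_outermorphism]
         linear_o[OF linear_outermorphism linear_wedge_right]])
  show "outermorphism t (of_vec v \<^bold>\<and> blade A) = of_vec (t v) \<^bold>\<and> outermorphism t (blade A)" for A
    unfolding blade_eq_wedge_list wedge_list_Cons[symmetric] outermorphism_wedge_list[OF assms]
    by simp
qed

lemma outermorphism_compose:
  assumes "linear s" "linear t"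
  shows "outermorphism s (outermorphism t X) = outermorphism (s \<circ> t) X"
  by (rule multivector_eqI[of "\<lambda>X. outermorphism s (outermorphism t X)" "outermorphism (s \<circ> t)",
        OF linear_o[OF linear_outermorphism linear_outermorphism] linear_outermorphism])
    (simp_all add: outermorphism_of_vec_wedge assms linear_compose)

lemma outermorphism_ident: "outermorphism (\<lambda>v. v) X = X"
  by (rule multivector_eqI[OF linear_outermorphism linear_ident])
    (simp_all add: outermorphism_of_vec_wedge linear_ident)

text \<open>The hypothesis says that \<open>u'\<close> is the adjoint of \<open>t\<close> applied to
  \<open>u\<close>. It will be used with \<open>t\<close> the metric and \<open>u\<close> the image
  of a basis vector under the inverse metric, so that \<open>u'\<close> is that basis
  vector.\<close>

lemma lcontr_outermorphism:
  assumes "linear t" and "\<And>v. u \<bullet> t v = u' \<bullet> v"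
  shows "of_vec u \<^bold>\<rfloor> outermorphism t Y = outermorphism t (of_vec u' \<^bold>\<rfloor> Y)"
  by (rule multivector_eqI[of "\<lambda>Y. of_vec u \<^bold>\<rfloor> outermorphism t Y"
        "\<lambda>Y. outermorphism t (of_vec u' \<^bold>\<rfloor> Y)",
        OF linear_o[OF linear_outermorphism linear_lcontr] linear_o[OF linear_lcontr linear_outermorphism]])
    (simp_all add: outermorphism_of_vec_wedge of_vec_lcontr_of_vec_wedge assms
      linear_0[OF linear_outermorphism] linear_diff[OF linear_outermorphism]
      linear_cmul[OF linear_outermorphism])

text \<open>Homogeneity of a product of vectors: in each summand of the coefficient at
  \<open>C\<close>, either \<open>A\<close> is no singleton and the first factor vanishes there, or
  \<open>C - A\<close> has the wrong size for the remaining factors.\<close>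

lemma wedge_list_nth_eq_0: "card C \<noteq> length vs \<Longrightarrow> wedge_list vs $ C = 0"
proof (induction vs arbitrary: C)
  case Nil
  then show ?case by (auto simp: wedge_list_def blade_def axis_def)
next
  case (Cons v vs)
  have "of_vec v $ A * wedge_list vs $ (C - A) = 0" if "A \<subseteq> C" for A
  proof (cases "card A = 1")
    case True
    then have "card (C - A) \<noteq> length vs"
      using Cons.prems that card_mono[of C A] by (simp add: card_Diff_subset finite)
    then show ?thesis using Cons.IH by simp
  next
    case False
    then have "A \<noteq> {\<mu>}" for \<mu> by auto
    then show ?thesis by (simp add: of_vec_def blade_def axis_def)
  qed
  then show ?case
    unfolding wedge_list_Cons wedge_def vec_lambda_beta
    by (intro sum.neutral ballI) (simp only: Pow_iff mult.assoc mult_zero_right)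
qed

text \<open>Outermorphisms preserve the grade, hence commute with every map that acts by a scalar on
  each grade.\<close>

lemma outermorphism_grade_scaling:
  fixes f :: "nat \<Rightarrow> real"
  shows "outermorphism t (\<chi> A. f (card A) * X $ A) = (\<chi> A. f (card A) * outermorphism t X $ A)"
proof -
  define D where "D X = (\<chi> A. f (card A) * X $ A)" for X :: "'a multivector"
  have D: "linear D" unfolding D_def by (rule linearI) (simp_all add: vec_eq_iff algebra_simps)
  have "D (blade A) = f (card A) *\<^sub>R blade A" for A
    by (auto simp: D_def vec_eq_iff blade_def axis_def)
  moreover have "D (outermorphism t (blade A)) = f (card A) *\<^sub>R outermorphism t (blade A)" for A
  proof -
    have "f (card C) * outermorphism t (blade A) $ C = f (card A) * outermorphism t (blade A) $ C" for C
      by (cases "card C = card A") (simp_all add: outermorphism_blade wedge_list_nth_eq_0)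
    then show ?thesis by (simp add: D_def vec_eq_iff)
  qed
  ultimately have "outermorphism t (D (blade A)) = D (outermorphism t (blade A))" for A
    by (simp add: linear_cmul[OF linear_outermorphism])
  with linear_o[OF D linear_outermorphism] linear_o[OF linear_outermorphism D]
  have "outermorphism t (D X) = D (outermorphism t X)"
    by (rule linear_eq_on_blades[of "\<lambda>X. outermorphism t (D X)" "\<lambda>X. D (outermorphism t X)"])
  then show ?thesis by (simp add: D_def)
qed

lemma outermorphism_grade_inv: "outermorphism t (grade_inv X) = grade_inv (outermorphism t X)"
  unfolding grade_inv_def by (rule outermorphism_grade_scaling)

lemma outermorphism_reversion: "outermorphism t (reversion X) = reversion (outermorphism t X)"
  unfolding reversion_def
  by (rule outermorphism_grade_scaling[where f = "\<lambda>k. (- 1) ^ (k * (k - 1) div 2)"])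

lemma reversion_reversion [simp]: "reversion (reversion X) = X"
  by (simp add: reversion_def vec_eq_iff flip: power_add mult.assoc)


section \<open>The pseudoscalar\<close>

lemma of_vec_wedge_pseudoscalar [simp]: "of_vec v \<^bold>\<and> blade UNIV = 0"
  using linear_eq_on_bvec[OF linear_of_vec_wedge linear_zero, of "blade UNIV"]
  by (simp add: bvec_wedge_blade)

text \<open>By homogeneity only the coefficient at \<open>UNIV\<close> survives, and the Gram
  determinant of \<open>v\<close> against the standard basis computes it.\<close>

lemma wedge_fam_eq_det:
  fixes v :: "'n::{finite,linorder} \<Rightarrow> 'n canonical_space"
  shows "wedge_fam v = det (\<chi> i j. v i $ j) *\<^sub>R blade UNIV"
proof -
  have "wedge_fam bvec = (blade UNIV :: 'n multivector)"
    by (simp add: wedge_fam_def blade_eq_wedge_list)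
  then have "wedge_fam v \<bullet> blade UNIV = det (\<chi> i j. v i $ j)"
    using inner_wedge_fam[of v bvec] by (simp add: inner_bvec)
  then have "wedge_fam v $ UNIV = det (\<chi> i j. v i $ j)"
    by (simp add: blade_def inner_axis)
  moreover have "wedge_fam v $ A = 0" if "A \<noteq> UNIV" for A
  proof -
    have "card A \<noteq> card (UNIV :: 'n set)"
      using that card_subset_eq[of UNIV A] by auto
    then show ?thesis unfolding wedge_fam_def by (intro wedge_list_nth_eq_0) simp
  qed
  ultimately show ?thesis by (auto simp: vec_eq_iff blade_def axis_def)
qed

text \<open>Makes the determinant of the metric a coefficient of an outermorphism, so that it can be
  differentiated by the rule for outermorphisms.\<close>

lemma outermorphism_pseudoscalar: "outermorphism t (blade UNIV) = det (matrix t) *\<^sub>R blade UNIV"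
proof -
  have "outermorphism t (blade UNIV) = wedge_fam (\<lambda>i. t (bvec i))"
    by (simp add: wedge_fam_def outermorphism_blade)
  \<comment> \<open>The images of the basis vectors are the columns of \<open>matrix t\<close>,
    while \<open>wedge_fam_eq_det\<close> arranges them as rows.\<close>
  also have "\<dots> = det (transpose (matrix t)) *\<^sub>R blade UNIV"
    by (simp add: wedge_fam_eq_det transpose_def matrix_def bvec_def)
  finally show ?thesis by (simp add: det_transpose)
qed

lemma lcontr_pseudoscalar_inner: "(reversion Y \<^bold>\<rfloor> blade UNIV) \<bullet> Z = blade UNIV \<bullet> (Y \<^bold>\<and> Z)"
  by (simp add: lcontr_inner)

text \<open>A contraction by \<open>u\<close> has no pseudoscalar component, because
  \<open>u\<close> wedged with the pseudoscalar is zero. Hence the two Leibniz terms of the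
  contracted product of \<open>Y\<close> and \<open>Z\<close> cancel against the
  pseudoscalar.\<close>

lemma of_vec_wedge_dual:
  "of_vec u \<^bold>\<and> (reversion (grade_inv Y) \<^bold>\<rfloor> blade UNIV) = - (reversion (of_vec u \<^bold>\<rfloor> Y) \<^bold>\<rfloor> blade UNIV)"
proof (rule inner_eqI)
  fix Z
  have "(of_vec u \<^bold>\<and> (reversion (grade_inv Y) \<^bold>\<rfloor> blade UNIV)) \<bullet> Z
      = blade UNIV \<bullet> (grade_inv Y \<^bold>\<and> (of_vec u \<^bold>\<rfloor> Z))"
    by (simp only: inner_commute[of _ Z] of_vec_lcontr_inner[symmetric])
      (simp only: inner_commute[of "of_vec u \<^bold>\<rfloor> Z"] lcontr_pseudoscalar_inner)
  also have "\<dots> = blade UNIV \<bullet> (of_vec u \<^bold>\<rfloor> (Y \<^bold>\<and> Z)) - blade UNIV \<bullet> ((of_vec u \<^bold>\<rfloor> Y) \<^bold>\<and> Z)"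
    by (simp add: of_vec_lcontr_wedge inner_add_right)
  also have "blade UNIV \<bullet> (of_vec u \<^bold>\<rfloor> (Y \<^bold>\<and> Z)) = 0"
    by (subst inner_commute) (simp only: of_vec_lcontr_inner of_vec_wedge_pseudoscalar inner_zero_right)
  finally show "(of_vec u \<^bold>\<and> (reversion (grade_inv Y) \<^bold>\<rfloor> blade UNIV)) \<bullet> Z
      = - (reversion (of_vec u \<^bold>\<rfloor> Y) \<^bold>\<rfloor> blade UNIV) \<bullet> Z"
    by (simp add: lcontr_pseudoscalar_inner)
qed

text \<open>Pairing with the complementary blade recovers each coefficient up to sign. This will
  make the Hodge star injective.\<close>

lemma lcontr_pseudoscalar_eq_0: "X \<^bold>\<rfloor> blade UNIV = 0 \<Longrightarrow> X = 0"
proof -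
  assume 0: "X \<^bold>\<rfloor> blade UNIV = 0"
  have "reversion X $ A = 0" for A
  proof -
    have "(reversion X \<^bold>\<and> blade (- A)) $ UNIV
        = (- 1) ^ inversions A (- A) * reversion X $ A"
      by (simp add: wedge_def blade_def axis_def Compl_eq_Diff_UNIV[symmetric] mult_delta_right)
    moreover have "blade UNIV \<bullet> (reversion X \<^bold>\<and> blade (- A)) = 0"
      using lcontr_inner[of X "blade UNIV" "blade (- A)"] 0 by simp
    ultimately show ?thesis by (simp add: blade_def inner_axis')
  qed
  then have "reversion X = 0" by (simp add: vec_eq_iff)
  then show ?thesis using reversion_reversion[of X] by (simp add: linear_0[OF linear_reversion])
qed


section \<open>Derivation extensions of endomorphisms\<close>

text \<open>The derivation of the exterior algebra that extends \<open>s\<close>, written in the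
  form of \<open>Lambda\<close> so that the two can be matched summand by summand.\<close>

definition derivation_ext ::
  "('n canonical_space \<Rightarrow> 'n canonical_space) \<Rightarrow> ('n::{finite,linorder}) multivector \<Rightarrow> 'n multivector" where
  "derivation_ext s X = (\<Sum>\<mu>\<in>UNIV. of_vec (s (bvec \<mu>)) \<^bold>\<and> (of_vec (bvec \<mu>) \<^bold>\<rfloor> X))"

lemma linear_derivation_ext: "linear (derivation_ext s)"
  unfolding derivation_ext_def
  by (rule linear_compose_sum) (auto intro: linear_o[OF linear_lcontr linear_wedge_right])

lemma derivation_ext_one [simp]: "derivation_ext s (blade {}) = 0"
  by (simp add: derivation_ext_def linear_0[OF linear_wedge_right])

text \<open>Contracting the new factor \<open>v\<close> reassembles \<open>s v\<close>. In the other
  summands the sign of the antiderivation rule cancels the sign of moving \<open>v\<close> to the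
  front.\<close>

lemma derivation_ext_of_vec_wedge:
  assumes "linear s"
  shows "derivation_ext s (of_vec v \<^bold>\<and> Y) = of_vec (s v) \<^bold>\<and> Y + of_vec v \<^bold>\<and> derivation_ext s Y"
proof -
  have "of_vec (s v) = of_vec (s (\<Sum>\<mu>\<in>UNIV. (v $ \<mu>) *\<^sub>R bvec \<mu>))" by (simp only: sum_bvec)
  also have "\<dots> = (\<Sum>\<mu>\<in>UNIV. (v $ \<mu>) *\<^sub>R of_vec (s (bvec \<mu>)))"
    by (simp add: linear_sum[OF assms] linear_cmul[OF assms]
        linear_sum[OF linear_of_vec] linear_cmul[OF linear_of_vec])
  finally have "of_vec (s v) \<^bold>\<and> Y = (\<Sum>\<mu>\<in>UNIV. (v $ \<mu>) *\<^sub>R (of_vec (s (bvec \<mu>)) \<^bold>\<and> Y))"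
    by (simp add: linear_sum[OF linear_wedge_left] linear_cmul[OF linear_wedge_left])
  then show ?thesis
    by (simp add: derivation_ext_def of_vec_lcontr_of_vec_wedge linear_diff[OF linear_wedge_right]
        linear_cmul[OF linear_wedge_right] linear_sum[OF linear_wedge_right] sum_subtractf inner_bvec
        of_vec_wedge_swap[of v] sum_negf)
qed

lemma derivation_ext_unique:
  assumes "linear D" "linear s" "D (blade {}) = 0"
    and "\<And>v Y. D (of_vec v \<^bold>\<and> Y) = of_vec (s v) \<^bold>\<and> Y + of_vec v \<^bold>\<and> D Y"
  shows "D X = derivation_ext s X"
  by (rule multivector_eqI[OF assms(1) linear_derivation_ext])
    (simp_all add: assms derivation_ext_of_vec_wedge)

lemma derivation_ext_add:
  "derivation_ext (\<lambda>v. s v + t v) X = derivation_ext s X + derivation_ext t X"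
  by (simp add: derivation_ext_def linear_add[OF linear_of_vec_wedge] sum.distrib)

lemma derivation_ext_uminus: "derivation_ext (\<lambda>v. - s v) X = - derivation_ext s X"
  by (simp add: derivation_ext_def linear_neg[OF linear_of_vec_wedge] sum_negf)

text \<open>Outermorphisms are multiplicative, so the conjugate is again a derivation and is
  identified by its values on vectors.\<close>

lemma derivation_ext_conj:
  assumes "linear G" "linear H" "linear s" and GH: "\<And>v. G (H v) = v"
  shows "outermorphism G (derivation_ext s (outermorphism H X)) = derivation_ext (\<lambda>v. G (s (H v))) X"
proof (rule derivation_ext_unique)
  show "linear (\<lambda>X. outermorphism G (derivation_ext s (outermorphism H X)))"
    by (intro linear_o[OF _ linear_outermorphism] linear_o[OF _ linear_derivation_ext]
        linear_outermorphism)
  show "linear (\<lambda>v. G (s (H v)))"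
    by (intro linear_o[OF _ assms(1)] linear_o[OF assms(2) assms(3)])
  have "outermorphism G (outermorphism H Y) = Y" for Y
    using outermorphism_compose[OF assms(1,2), of Y] outermorphism_ident[of Y] GH by (simp add: o_def)
  then show "outermorphism G (derivation_ext s (outermorphism H (of_vec v \<^bold>\<and> Y))) =
      of_vec (G (s (H v))) \<^bold>\<and> Y + of_vec v \<^bold>\<and> outermorphism G (derivation_ext s (outermorphism H Y))" for v Y
    by (simp add: outermorphism_of_vec_wedge assms derivation_ext_of_vec_wedge
        linear_add[OF linear_outermorphism])
qed (simp add: linear_0[OF linear_outermorphism])

text \<open>Passing to the adjoint exchanges wedge and contraction in each summand; expanding in the
  matrix entries of \<open>s'\<close> restores the original form.\<close>

lemma derivation_ext_adjoint:
  assumes "\<And>u v. s u \<bullet> v = u \<bullet> s' v"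
  shows "derivation_ext s X \<bullet> Y = X \<bullet> derivation_ext s' Y"
proof -
  have *: "of_vec (s (bvec \<mu>)) \<^bold>\<rfloor> Y = (\<Sum>\<nu>\<in>UNIV. (s' (bvec \<nu>) $ \<mu>) *\<^sub>R (of_vec (bvec \<nu>) \<^bold>\<rfloor> Y))" for \<mu>
  proof -
    have "s (bvec \<mu>) = (\<Sum>\<nu>\<in>UNIV. (s' (bvec \<nu>) $ \<mu>) *\<^sub>R bvec \<nu>)"
      using sum_bvec[of "s (bvec \<mu>)"] assms[of "bvec \<mu>" "bvec _"] by (simp add: inner_bvec)
    then show ?thesis
      by (simp add: linear_sum[OF linear_of_vec_lcontr] linear_cmul[OF linear_of_vec_lcontr])
  qed
  have "derivation_ext s X \<bullet> Y = (\<Sum>\<mu>\<in>UNIV. X \<bullet> (of_vec (bvec \<mu>) \<^bold>\<and> (of_vec (s (bvec \<mu>)) \<^bold>\<rfloor> Y)))"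
    by (simp add: derivation_ext_def inner_sum_left inner_commute[of "_ \<^bold>\<and> _" Y]
        flip: of_vec_lcontr_inner) (simp add: inner_commute[of "_ \<^bold>\<rfloor> Y"] of_vec_lcontr_inner)
  also have "\<dots> = X \<bullet> (\<Sum>\<mu>\<in>UNIV. \<Sum>\<nu>\<in>UNIV. (s' (bvec \<nu>) $ \<mu>) *\<^sub>R (of_vec (bvec \<mu>) \<^bold>\<and> (of_vec (bvec \<nu>) \<^bold>\<rfloor> Y)))"
    by (simp only: * inner_sum_right linear_sum[OF linear_wedge_right] linear_cmul[OF linear_wedge_right])
  also have "\<dots> = X \<bullet> (\<Sum>\<nu>\<in>UNIV. of_vec (\<Sum>\<mu>\<in>UNIV. (s' (bvec \<nu>) $ \<mu>) *\<^sub>R bvec \<mu>) \<^bold>\<and> (of_vec (bvec \<nu>) \<^bold>\<rfloor> Y))"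
    by (subst sum.swap) (simp only: linear_sum[OF linear_of_vec_wedge] linear_cmul[OF linear_of_vec_wedge])
  finally show ?thesis by (simp only: sum_bvec derivation_ext_def)
qed

text \<open>Contracting the vanishing product of a vector with the pseudoscalar shows that each
  summand multiplies the pseudoscalar by a diagonal entry of \<open>s\<close>; together they give
  the trace.\<close>

lemma derivation_ext_pseudoscalar:
  fixes s :: "('n::{finite,linorder}) canonical_space \<Rightarrow> 'n canonical_space"
  shows "derivation_ext s (blade UNIV) = (\<Sum>\<mu>\<in>UNIV. s (bvec \<mu>) $ \<mu>) *\<^sub>R blade UNIV"
proof -
  have "of_vec u \<^bold>\<and> (of_vec (bvec \<mu>) \<^bold>\<rfloor> blade UNIV) = (u $ \<mu>) *\<^sub>R blade UNIV"
    for u :: "'n canonical_space" and \<mu>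
    using of_vec_lcontr_of_vec_wedge[of "bvec \<mu>" u "blade UNIV"]
    by (simp add: inner_bvec linear_0[OF linear_lcontr])
  then show ?thesis by (simp add: derivation_ext_def scaleR_sum_left)
qed

lemma self_eq_neg_vec: "x = - x \<Longrightarrow> x = 0" for x :: "'a::real_vector"
  by (metis add.right_inverse scaleR_2 scaleR_eq_0_iff zero_neq_numeral)

text \<open>Symmetry of \<open>s\<close> in its two arguments (torsion-freeness) kills the part of the sum that
  contracts \<open>Y\<close> twice, as contractions anticommute.\<close>

lemma sum_lcontr_derivation_ext:
  assumes sym: "\<And>\<mu> \<nu>. s \<mu> (bvec \<nu>) = s \<nu> (bvec \<mu>)"
  shows "(\<Sum>\<mu>\<in>UNIV. of_vec (bvec \<mu>) \<^bold>\<rfloor> derivation_ext (s \<mu>) Y) =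
    (\<Sum>\<nu>\<in>UNIV. (\<Sum>\<mu>\<in>UNIV. s \<nu> (bvec \<mu>) $ \<mu>) *\<^sub>R (of_vec (bvec \<nu>) \<^bold>\<rfloor> Y))"
proof -
  define T where "T \<mu> \<nu> = of_vec (s \<mu> (bvec \<nu>)) \<^bold>\<and> (of_vec (bvec \<mu>) \<^bold>\<rfloor> (of_vec (bvec \<nu>) \<^bold>\<rfloor> Y))" for \<mu> \<nu>
  have "T \<mu> \<nu> = - T \<nu> \<mu>" for \<mu> \<nu>
    unfolding T_def sym[of \<mu> \<nu>] of_vec_lcontr_swap[of "bvec \<mu>"]
    by (simp add: linear_neg[OF linear_wedge_right])
  then have "(\<Sum>\<mu>\<in>UNIV. \<Sum>\<nu>\<in>UNIV. T \<mu> \<nu>) = - (\<Sum>\<mu>\<in>UNIV. \<Sum>\<nu>\<in>UNIV. T \<nu> \<mu>)"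
    unfolding sum_negf[symmetric] by (intro sum.cong refl)
  also have "\<dots> = - (\<Sum>\<mu>\<in>UNIV. \<Sum>\<nu>\<in>UNIV. T \<mu> \<nu>)" by (subst sum.swap) simp
  finally have T0: "(\<Sum>\<mu>\<in>UNIV. \<Sum>\<nu>\<in>UNIV. T \<mu> \<nu>) = 0"
    by (simp only: self_eq_neg_vec)
  have "(\<Sum>\<mu>\<in>UNIV. of_vec (bvec \<mu>) \<^bold>\<rfloor> derivation_ext (s \<mu>) Y) =
      (\<Sum>\<mu>\<in>UNIV. \<Sum>\<nu>\<in>UNIV. (s \<mu> (bvec \<nu>) $ \<mu>) *\<^sub>R (of_vec (bvec \<nu>) \<^bold>\<rfloor> Y) - T \<mu> \<nu>)"
    by (simp add: derivation_ext_def linear_sum[OF linear_lcontr] of_vec_lcontr_of_vec_wedge T_def inner_bvec)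
  \<comment> \<open>Symmetry is used a second time, to turn the remaining coefficients into the
    trace of \<open>s \<nu>\<close>.\<close>
  also have "\<dots> = (\<Sum>\<mu>\<in>UNIV. \<Sum>\<nu>\<in>UNIV. (s \<nu> (bvec \<mu>) $ \<mu>) *\<^sub>R (of_vec (bvec \<nu>) \<^bold>\<rfloor> Y))"
    by (simp add: sum_subtractf T0 sym)
  also have "\<dots> = (\<Sum>\<nu>\<in>UNIV. (\<Sum>\<mu>\<in>UNIV. s \<nu> (bvec \<mu>) $ \<mu>) *\<^sub>R (of_vec (bvec \<nu>) \<^bold>\<rfloor> Y))"
    by (subst sum.swap) (simp add: scaleR_sum_left)
  finally show ?thesis .
qed


section \<open>Partial derivatives of fields\<close>

text \<open>\<open>frechet_derivative\<close> picks a derivative by choice, so \<open>pd\<close> is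
  informative only under this condition; the rules below carry both along together.\<close>

definition coord_differentiable ::
  "('m, 'n::finite) chart \<Rightarrow> ('m \<Rightarrow> 'b::real_normed_vector) \<Rightarrow> 'm \<Rightarrow> bool" where
  "coord_differentiable c F p \<longleftrightarrow> (F \<circ> chart_inv c) differentiable (at (snd c p))"

lemma coord_differentiable_pdI:
  assumes "((\<lambda>y. F (chart_inv c y)) has_derivative F') (at (snd c p))"
  shows "coord_differentiable c F p" "pd c \<mu> F p = F' (bvec \<mu>)"
  using assms frechet_derivative_at[OF assms]
  by (auto simp: coord_differentiable_def pd_def differentiable_def o_def)

lemma coord_differentiableD:
  assumes "coord_differentiable c F p"
  obtains F' where "((\<lambda>y. F (chart_inv c y)) has_derivative F') (at (snd c p))"
    "\<And>\<mu>. pd c \<mu> F p = F' (bvec \<mu>)"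
proof -
  from assms obtain F' where F': "((\<lambda>y. F (chart_inv c y)) has_derivative F') (at (snd c p))"
    by (auto simp: coord_differentiable_def differentiable_def o_def)
  show thesis by (rule that[OF F' coord_differentiable_pdI(2)[OF F']])
qed

lemma ddir_bvec [simp]: "ddir c (bvec \<mu>) F p = pd c \<mu> F p"
  by (simp add: ddir_def inner_bvec bvec_nth if_distrib[of "\<lambda>x. x *\<^sub>R _"] cong: if_cong)

lemma coord_differentiable_const [simp]: "coord_differentiable c (\<lambda>_. k) p"
  and pd_const [simp]: "pd c \<mu> (\<lambda>_. k) p = 0"
  by (rule coord_differentiable_pdI[OF has_derivative_const])+

lemma coord_differentiable_linear:
  assumes "bounded_linear f" "coord_differentiable c F p"
  shows "coord_differentiable c (\<lambda>q. f (F q)) p" "pd c \<mu> (\<lambda>q. f (F q)) p = f (pd c \<mu> F p)"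
proof -
  obtain F' where F': "((\<lambda>y. F (chart_inv c y)) has_derivative F') (at (snd c p))"
    "\<And>\<mu>. pd c \<mu> F p = F' (bvec \<mu>)"
    using coord_differentiableD[OF assms(2)] by blast
  note * = coord_differentiable_pdI[OF bounded_linear.has_derivative[OF assms(1) F'(1)]]
  show "coord_differentiable c (\<lambda>q. f (F q)) p" "pd c \<mu> (\<lambda>q. f (F q)) p = f (pd c \<mu> F p)"
    using * by (simp_all add: F'(2))
qed

lemma coord_differentiable_sum:
  assumes "\<And>i. i \<in> I \<Longrightarrow> coord_differentiable c (F i) p"
  shows "coord_differentiable c (\<lambda>q. \<Sum>i\<in>I. F i q) p"
    "pd c \<mu> (\<lambda>q. \<Sum>i\<in>I. F i q) p = (\<Sum>i\<in>I. pd c \<mu> (F i) p)"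
proof -
  have "\<forall>i\<in>I. \<exists>F'. ((\<lambda>y. F i (chart_inv c y)) has_derivative F') (at (snd c p))
      \<and> (\<forall>\<mu>. pd c \<mu> (F i) p = F' (bvec \<mu>))"
    using coord_differentiableD[OF assms] by metis
  then obtain F' where F':
    "\<And>i. i \<in> I \<Longrightarrow> ((\<lambda>y. F i (chart_inv c y)) has_derivative F' i) (at (snd c p))"
    "\<And>i \<mu>. i \<in> I \<Longrightarrow> pd c \<mu> (F i) p = F' i (bvec \<mu>)"
    by metis
  note * = coord_differentiable_pdI[OF has_derivative_sum[OF F'(1)]]
  show "coord_differentiable c (\<lambda>q. \<Sum>i\<in>I. F i q) p"
    "pd c \<mu> (\<lambda>q. \<Sum>i\<in>I. F i q) p = (\<Sum>i\<in>I. pd c \<mu> (F i) p)"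
    using * by (simp_all add: F'(2))
qed

lemma coord_differentiable_add:
  assumes "coord_differentiable c F p" "coord_differentiable c K p"
  shows "coord_differentiable c (\<lambda>q. F q + K q) p"
    "pd c \<mu> (\<lambda>q. F q + K q) p = pd c \<mu> F p + pd c \<mu> K p"
proof -
  obtain F' where F': "((\<lambda>y. F (chart_inv c y)) has_derivative F') (at (snd c p))"
    "\<And>\<mu>. pd c \<mu> F p = F' (bvec \<mu>)"
    using coord_differentiableD[OF assms(1)] by blast
  obtain K' where K': "((\<lambda>y. K (chart_inv c y)) has_derivative K') (at (snd c p))"
    "\<And>\<mu>. pd c \<mu> K p = K' (bvec \<mu>)"
    using coord_differentiableD[OF assms(2)] by blast
  note * = coord_differentiable_pdI[OF has_derivative_add[OF F'(1) K'(1)]]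
  show "coord_differentiable c (\<lambda>q. F q + K q) p"
    "pd c \<mu> (\<lambda>q. F q + K q) p = pd c \<mu> F p + pd c \<mu> K p"
    using * by (simp_all add: F'(2) K'(2))
qed

text \<open>The last hypothesis links the two base points: \<open>\<phi>\<close> is differentiated
  at \<open>F p\<close>, while the coordinate form of \<open>F\<close> is evaluated at
  \<open>snd c p\<close>.\<close>

lemma coord_differentiable_chain:
  fixes F :: "'m \<Rightarrow> real"
  assumes "coord_differentiable c F p" "(\<phi> has_real_derivative d) (at (F p))"
    and "chart_inv c (snd c p) = p"
  shows "coord_differentiable c (\<lambda>q. \<phi> (F q)) p" "pd c \<mu> (\<lambda>q. \<phi> (F q)) p = d * pd c \<mu> F p"
proof -
  obtain F' where F': "((\<lambda>y. F (chart_inv c y)) has_derivative F') (at (snd c p))"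
    "\<And>\<mu>. pd c \<mu> F p = F' (bvec \<mu>)"
    using coord_differentiableD[OF assms(1)] by blast
  have "(\<phi> has_derivative (*) d) (at (F (chart_inv c (snd c p))))"
    using assms(2,3) by (simp add: has_field_derivative_def)
  note * = coord_differentiable_pdI[OF has_derivative_compose[OF F'(1) this]]
  show "coord_differentiable c (\<lambda>q. \<phi> (F q)) p" "pd c \<mu> (\<lambda>q. \<phi> (F q)) p = d * pd c \<mu> F p"
    using * by (simp_all add: F'(2))
qed

text \<open>A derivative depends only on the germ. The eventual form also serves the volume element,
  whose sign is constant only near a point.\<close>

lemma coord_differentiable_cong:
  assumes "\<forall>\<^sub>F y in nhds (snd c p). F (chart_inv c y) = K (chart_inv c y)"
  shows "coord_differentiable c F p \<longleftrightarrow> coord_differentiable c K p" "pd c \<mu> F p = pd c \<mu> K p"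
proof -
  obtain S where S: "open S" "snd c p \<in> S" "\<And>y. y \<in> S \<Longrightarrow> F (chart_inv c y) = K (chart_inv c y)"
    using assms unfolding eventually_nhds by blast
  have iff: "((F \<circ> chart_inv c) has_derivative D) (at (snd c p))
      \<longleftrightarrow> ((K \<circ> chart_inv c) has_derivative D) (at (snd c p))" for D
    using has_derivative_transform_within_open[OF _ S(1,2), of "F \<circ> chart_inv c" D UNIV "K \<circ> chart_inv c"]
      has_derivative_transform_within_open[OF _ S(1,2), of "K \<circ> chart_inv c" D UNIV "F \<circ> chart_inv c"] S(3)
    by auto
  show "coord_differentiable c F p \<longleftrightarrow> coord_differentiable c K p"
    by (simp add: coord_differentiable_def differentiable_def iff)
  show "pd c \<mu> F p = pd c \<mu> K p"
    by (simp add: pd_def frechet_derivative_def iff)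
qed

section \<open>Differentiation of fields at a point of a coordinate domain\<close>

locale chart_point =
  fixes c :: "('m::topological_space, 'n::{finite,linorder}) chart" and U p
  assumes chart: "topological_chart c" and open_U: "open U" and U_subset: "U \<subseteq> fst c" and p: "p \<in> U"
begin

lemma chart_inv_coord [simp]: "q \<in> U \<Longrightarrow> chart_inv c (snd c q) = q"
  using chart U_subset by (auto simp: topological_chart_def homeomorphism_def)

text \<open>The chart is a homeomorphism, so the coordinate image of \<open>U\<close> is a
  neighbourhood of the image of \<open>p\<close>.\<close>

lemma eventually_chart_inv: "\<forall>\<^sub>F y in nhds (snd c p). chart_inv c y \<in> U"
proof -
  have "open (snd c ` U)"
    using chart open_U U_subset homeomorphism_imp_open_map[of "fst c" "snd c ` fst c" "snd c" "chart_inv c" U]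
    by (auto simp: topological_chart_def openin_open_eq)
  then show ?thesis
    unfolding eventually_nhds using p by (intro exI[of _ "snd c ` U"]) auto
qed

lemma coord_differentiable_cong_on:
  assumes "\<And>q. q \<in> U \<Longrightarrow> F q = K q"
  shows "coord_differentiable c F p \<longleftrightarrow> coord_differentiable c K p" "pd c \<mu> F p = pd c \<mu> K p"
proof -
  have "\<forall>\<^sub>F y in nhds (snd c p). F (chart_inv c y) = K (chart_inv c y)"
    using eventually_chart_inv by (rule eventually_mono) (rule assms)
  then show "coord_differentiable c F p \<longleftrightarrow> coord_differentiable c K p" "pd c \<mu> F p = pd c \<mu> K p"
    by (rule coord_differentiable_cong)+
qed

lemma smooth_field_coord_differentiable: "smooth_field c U F \<Longrightarrow> coord_differentiable c F p"
proof -
  assume "smooth_field c U F"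
  then have "C_k_on (Suc 0) (snd c ` U) (F \<circ> chart_inv c)"
    unfolding smooth_field_def smooth_on_def by blast
  then show ?thesis using p by (simp add: coord_differentiable_def)
qed

lemma coord_differentiable_bilinear:
  assumes "bounded_bilinear B" "coord_differentiable c F p" "coord_differentiable c K p"
  shows "coord_differentiable c (\<lambda>q. B (F q) (K q)) p"
    "pd c \<mu> (\<lambda>q. B (F q) (K q)) p = B (F p) (pd c \<mu> K p) + B (pd c \<mu> F p) (K p)"
proof -
  obtain F' where F': "((\<lambda>y. F (chart_inv c y)) has_derivative F') (at (snd c p))"
    "\<And>\<mu>. pd c \<mu> F p = F' (bvec \<mu>)"
    using coord_differentiableD[OF assms(2)] by blast
  obtain K' where K': "((\<lambda>y. K (chart_inv c y)) has_derivative K') (at (snd c p))"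
    "\<And>\<mu>. pd c \<mu> K p = K' (bvec \<mu>)"
    using coord_differentiableD[OF assms(3)] by blast
  note * = coord_differentiable_pdI[OF bounded_bilinear.FDERIV[OF assms(1) F'(1) K'(1)]]
  show "coord_differentiable c (\<lambda>q. B (F q) (K q)) p"
    "pd c \<mu> (\<lambda>q. B (F q) (K q)) p = B (F p) (pd c \<mu> K p) + B (pd c \<mu> F p) (K p)"
    using * p by (simp_all add: F'(2) K'(2))
qed

lemmas coord_differentiable_scaleR = coord_differentiable_bilinear[OF bounded_bilinear_scaleR]

lemmas coord_differentiable_nth = coord_differentiable_linear[OF bounded_linear_vec_nth]

lemma coord_differentiable_wedge:
  fixes F K :: "'m \<Rightarrow> ('k::{finite,linorder}) multivector"
  assumes "coord_differentiable c F p" "coord_differentiable c K p"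
  shows "coord_differentiable c (\<lambda>q. F q \<^bold>\<and> K q) p"
    "pd c \<mu> (\<lambda>q. F q \<^bold>\<and> K q) p = F p \<^bold>\<and> pd c \<mu> K p + pd c \<mu> F p \<^bold>\<and> K p"
  using coord_differentiable_bilinear[OF bilinear_wedge[unfolded bilinear_conv_bounded_bilinear]] assms
  by blast+

lemma coord_differentiable_of_vec:
  fixes F :: "'m \<Rightarrow> real ^ ('k::{finite,linorder})"
  assumes "coord_differentiable c F p"
  shows "coord_differentiable c (\<lambda>q. of_vec (F q)) p" "pd c \<mu> (\<lambda>q. of_vec (F q)) p = of_vec (pd c \<mu> F p)"
  using coord_differentiable_linear[OF _ assms] linear_of_vec linear_conv_bounded_linear by blast+

lemma coord_differentiable_wedge_list:
  fixes F :: "'i \<Rightarrow> 'm \<Rightarrow> real ^ ('k::{finite,linorder})"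
  assumes "\<And>i. coord_differentiable c (F i) p"
  shows "coord_differentiable c (\<lambda>q. wedge_list (map (\<lambda>i. F i q) xs)) p"
proof (induction xs)
  case Nil
  show ?case by (simp add: wedge_list_def)
next
  case (Cons x xs)
  then show ?case
    by (simp add: wedge_list_Cons coord_differentiable_wedge coord_differentiable_of_vec assms)
qed

text \<open>Reduces differentiability of determinants to that of wedge products.\<close>

lemma det_eq_wedge_fam: "det A = wedge_fam (\<lambda>i. A $ i) $ UNIV"
  for A :: "real ^ ('k::{finite,linorder}) ^ ('k::{finite,linorder})"
  by (simp add: wedge_fam_eq_det blade_def)

lemma coord_differentiable_det:
  fixes A :: "'m \<Rightarrow> real ^ ('k::{finite,linorder}) ^ ('k::{finite,linorder})"
  assumes "\<And>i. coord_differentiable c (\<lambda>q. A q $ i) p"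
  shows "coord_differentiable c (\<lambda>q. det (A q)) p"
  unfolding det_eq_wedge_fam wedge_fam_def
  by (intro coord_differentiable_nth coord_differentiable_wedge_list assms)

lemma coord_differentiable_vecI:
  fixes F :: "'m \<Rightarrow> real ^ 'k"
  assumes "\<And>i. coord_differentiable c (\<lambda>q. F q $ i) p"
  shows "coord_differentiable c F p"
proof -
  have "coord_differentiable c (\<lambda>q. \<Sum>i\<in>UNIV. (F q $ i) *\<^sub>R bvec i) p"
    by (intro coord_differentiable_sum coord_differentiable_scaleR assms coord_differentiable_const)
  then show ?thesis by (simp only: sum_bvec)
qed

text \<open>Endomorphism fields take values in a plain function type, so the product rule is
  obtained by expanding \<open>V\<close> in the fixed basis.\<close>

lemma coord_differentiable_endo:
  assumes lin: "\<And>q. q \<in> U \<Longrightarrow> linear (t q)"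
    and t: "\<And>i. coord_differentiable c (\<lambda>q. t q (bvec i)) p"
    and V: "coord_differentiable c V p"
  shows "coord_differentiable c (\<lambda>q. t q (V q)) p"
    "pd c \<mu> (\<lambda>q. t q (V q)) p = pd c \<mu> (\<lambda>q. t q (V p)) p + t p (pd c \<mu> V p)"
proof -
  have expand: "t q v = (\<Sum>i\<in>UNIV. (v $ i) *\<^sub>R t q (bvec i))" if "q \<in> U" for q v
    using sum_bvec[of v] linear_sum[OF lin[OF that], of "\<lambda>i. (v $ i) *\<^sub>R bvec i" UNIV]
    by (simp add: linear_cmul[OF lin[OF that]])
  note S = coord_differentiable_scaleR coord_differentiable_nth t
  have 1: "coord_differentiable c (\<lambda>q. t q (V q)) p"
      "pd c \<mu> (\<lambda>q. t q (V q)) p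
         = (\<Sum>i\<in>UNIV. (V p $ i) *\<^sub>R pd c \<mu> (\<lambda>q. t q (bvec i)) p + (pd c \<mu> V p $ i) *\<^sub>R t p (bvec i))"
    if "coord_differentiable c V p" for V
    using coord_differentiable_cong_on[of "\<lambda>q. t q (V q)" "\<lambda>q. \<Sum>i\<in>UNIV. (V q $ i) *\<^sub>R t q (bvec i)"]
      coord_differentiable_sum[of UNIV c "\<lambda>i q. (V q $ i) *\<^sub>R t q (bvec i)"] that
    by (simp_all add: expand S)
  show "coord_differentiable c (\<lambda>q. t q (V q)) p" by (rule 1(1)[OF V])
  have "pd c \<mu> (\<lambda>q. t q (V p)) p = (\<Sum>i\<in>UNIV. (V p $ i) *\<^sub>R pd c \<mu> (\<lambda>q. t q (bvec i)) p)"
    using 1(2)[of "\<lambda>_. V p"] by simp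
  moreover have "t p (pd c \<mu> V p) = (\<Sum>i\<in>UNIV. (pd c \<mu> V p $ i) *\<^sub>R t p (bvec i))"
    by (rule expand[OF p])
  ultimately show "pd c \<mu> (\<lambda>q. t q (V q)) p = pd c \<mu> (\<lambda>q. t q (V p)) p + t p (pd c \<mu> V p)"
    by (simp add: 1(2)[OF V] sum.distrib)
qed

lemma linear_pd_endo:
  assumes lin: "\<And>q. q \<in> U \<Longrightarrow> linear (t q)"
    and t: "\<And>v. coord_differentiable c (\<lambda>q. t q v) p"
  shows "linear (\<lambda>v. pd c \<mu> (\<lambda>q. t q v) p)"
proof (rule linearI)
  show "pd c \<mu> (\<lambda>q. t q (u + v)) p = pd c \<mu> (\<lambda>q. t q u) p + pd c \<mu> (\<lambda>q. t q v) p" for u v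
    using coord_differentiable_cong_on(2)[of "\<lambda>q. t q (u + v)" "\<lambda>q. t q u + t q v" \<mu>]
      coord_differentiable_add(2)[OF t t]
    by (simp add: linear_add[OF lin])
  show "pd c \<mu> (\<lambda>q. t q (r *\<^sub>R v)) p = r *\<^sub>R pd c \<mu> (\<lambda>q. t q v) p" for r v
    using coord_differentiable_cong_on(2)[of "\<lambda>q. t q (r *\<^sub>R v)" "\<lambda>q. r *\<^sub>R t q v" \<mu>]
      coord_differentiable_linear(2)[OF bounded_linear_scaleR_right t, of \<mu> r v]
    by (simp add: linear_cmul[OF lin])
qed

text \<open>As \<open>s\<close> inverts \<open>t p\<close>, the derivative of each factor
  \<open>t q (bvec i)\<close> is the derivative of \<open>t\<close> composed with \<open>s\<close>,
  applied to the factor itself. By the Leibniz rule a product of such factors is acted on by the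
  derivation extension; the second term comes from the varying coefficients of
  \<open>X\<close>.\<close>

lemma coord_differentiable_outermorphism:
  fixes t :: "'m \<Rightarrow> 'n canonical_space \<Rightarrow> 'n canonical_space"
  assumes lin: "\<And>q. q \<in> U \<Longrightarrow> linear (t q)"
    and t: "\<And>v. coord_differentiable c (\<lambda>q. t q v) p"
    and s: "linear s" "\<And>v. s (t p v) = v"
    and X: "coord_differentiable c X p"
  shows "coord_differentiable c (\<lambda>q. outermorphism (t q) (X q)) p"
    "pd c \<mu> (\<lambda>q. outermorphism (t q) (X q)) p
       = derivation_ext (\<lambda>v. pd c \<mu> (\<lambda>q. t q (s v)) p) (outermorphism (t p) (X p))
         + outermorphism (t p) (pd c \<mu> X p)"
proof -
  define D where "D = derivation_ext (\<lambda>v. pd c \<mu> (\<lambda>q. t q (s v)) p)"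
  define W where "W xs q = wedge_list (map (\<lambda>i. t q (bvec i)) xs)" for xs q
  have d: "linear (\<lambda>v. pd c \<mu> (\<lambda>q. t q (s v)) p)"
    by (rule linear_o[OF s(1) linear_pd_endo[OF lin t]])
  have W: "coord_differentiable c (W xs) p" for xs
    unfolding W_def by (rule coord_differentiable_wedge_list[OF t])
  have "pd c \<mu> (W xs) p = D (W xs p)" for xs
  proof (induction xs)
    case Nil
    show ?case by (simp add: W_def wedge_list_def D_def)
  next
    case (Cons x xs)
    have "W (x # xs) q = of_vec (t q (bvec x)) \<^bold>\<and> W xs q" for q
      by (simp add: W_def wedge_list_Cons)
    then show ?case
      using Cons.IH
      by (simp add: coord_differentiable_wedge coord_differentiable_of_vec t W D_def
          derivation_ext_of_vec_wedge[OF d] s)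
  qed
  then have blade: "coord_differentiable c (\<lambda>q. outermorphism (t q) (blade A)) p"
    "pd c \<mu> (\<lambda>q. outermorphism (t q) (blade A)) p = D (outermorphism (t p) (blade A))" for A
    using W[of "sorted_list_of_set A"] by (simp_all add: outermorphism_blade W_def[abs_def])
  have expand: "outermorphism f Z = (\<Sum>A\<in>UNIV. (Z $ A) *\<^sub>R outermorphism f (blade A))"
    for f :: "'n canonical_space \<Rightarrow> 'n canonical_space" and Z
    by (simp add: outermorphism_def[of f Z] outermorphism_blade)
  show "coord_differentiable c (\<lambda>q. outermorphism (t q) (X q)) p"
    unfolding expand[of _ "X _"]
    by (intro coord_differentiable_sum coord_differentiable_scaleR coord_differentiable_nth X blade)
  have "pd c \<mu> (\<lambda>q. outermorphism (t q) (X q)) p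
      = (\<Sum>A\<in>UNIV. (X p $ A) *\<^sub>R D (outermorphism (t p) (blade A))
          + (pd c \<mu> X p $ A) *\<^sub>R outermorphism (t p) (blade A))"
    unfolding expand[of _ "X _"]
    by (simp add: coord_differentiable_sum coord_differentiable_scaleR coord_differentiable_nth X blade)
  also have "\<dots> = D (outermorphism (t p) (X p)) + outermorphism (t p) (pd c \<mu> X p)"
    by (simp add: expand[of _ "X p"] expand[of _ "pd c \<mu> X p"] sum.distrib D_def
        linear_sum[OF linear_derivation_ext] linear_cmul[OF linear_derivation_ext])
  finally show "pd c \<mu> (\<lambda>q. outermorphism (t q) (X q)) p
       = derivation_ext (\<lambda>v. pd c \<mu> (\<lambda>q. t q (s v)) p) (outermorphism (t p) (X p))
         + outermorphism (t p) (pd c \<mu> X p)"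
    by (simp add: D_def)
qed

end


section \<open>The Levi-Civita connection\<close>

text \<open>Here \<open>H\<close> stands for the inverse metric and \<open>d \<mu>\<close> for the \<open>\<mu>\<close>-th partial derivative of the
  metric.\<close>

definition christoffel ::
  "('n canonical_space \<Rightarrow> 'n canonical_space) \<Rightarrow> ('n \<Rightarrow> 'n canonical_space \<Rightarrow> 'n canonical_space)
     \<Rightarrow> 'n canonical_space \<Rightarrow> ('n::finite) canonical_space \<Rightarrow> 'n canonical_space" where
  "christoffel H d a b = (1/2) *\<^sub>R
     H (\<Sum>\<mu>\<in>UNIV. (a $ \<mu>) *\<^sub>R d \<mu> b + (b $ \<mu>) *\<^sub>R d \<mu> a - (a \<bullet> d \<mu> b) *\<^sub>R bvec \<mu>)"

text \<open>On the half line that contains \<open>d\<close>, the absolute value is multiplication by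
  the constant \<open>sgn d\<close>. This covers metrics of every signature.\<close>

lemma has_real_derivative_sqrt_abs:
  assumes "d \<noteq> (0::real)"
  shows "((\<lambda>x. sqrt \<bar>x\<bar>) has_real_derivative sqrt \<bar>d\<bar> / (2 * d)) (at d)"
proof (rule has_field_derivative_transform_within_open[of "\<lambda>x. sqrt (sgn d * x)" _ _ "{x. sgn d * x > 0}"])
  have "sgn d * d > 0" using assms by (simp add: sgn_if)
  then have "((\<lambda>x. sqrt (sgn d * x)) has_real_derivative inverse (sqrt (sgn d * d)) / 2 * sgn d) (at d)"
    by (auto intro!: derivative_eq_intros)
  moreover have "inverse (sqrt (sgn d * d)) / 2 * sgn d = sqrt \<bar>d\<bar> / (2 * d)"
    using assms by (auto simp: sgn_if abs_if field_simps)
  ultimately show "((\<lambda>x. sqrt (sgn d * x)) has_real_derivative sqrt \<bar>d\<bar> / (2 * d)) (at d)" by (simp only:)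
  show "open {x. sgn d * x > 0}" by (intro open_Collect_less continuous_intros)
  show "sqrt (sgn d * x) = sqrt \<bar>x\<bar>" if "x \<in> {x. sgn d * x > 0}" for x
    using that by (auto simp: sgn_if split: if_splits)
qed (use assms in \<open>simp add: sgn_if\<close>)

section \<open>The metric and its inverse near a point\<close>

locale metric_point = chart_point c U p
  for c :: "('m::topological_space, 'n::{finite,linorder}) chart" and U p +
  fixes g :: "('m, 'n) endo_field"
  assumes metric: "metric_structure c U g"
begin

lemma linear_g: "q \<in> U \<Longrightarrow> linear (g q)"
  using metric by (simp add: metric_structure_def)

lemma g_sym: "q \<in> U \<Longrightarrow> g q u \<bullet> v = u \<bullet> g q v"
  using metric adjoint_works[OF linear_g, of q u v] by (simp add: metric_structure_def)

lemma det_g: "q \<in> U \<Longrightarrow> det (matrix (g q)) \<noteq> 0"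
  using metric by (simp add: metric_structure_def)

lemma
  assumes "q \<in> U"
  shows linear_inv_g: "linear (inv (g q))"
    and g_inv_g [simp]: "g q (inv (g q) v) = v"
    and inv_g_g [simp]: "inv (g q) (g q v) = v"
proof -
  have "invertible (matrix (g q))" using det_g[OF assms] by (simp add: invertible_det_nz)
  then obtain k where k: "linear k" "g q \<circ> k = id" "k \<circ> g q = id"
    using matrix_invertible[OF linear_g[OF assms]] by blast
  moreover have "inv (g q) = k" using inv_unique_comp[OF k(2,3)] .
  ultimately show "linear (inv (g q))" "g q (inv (g q) v) = v" "inv (g q) (g q v) = v"
    by (simp_all add: pointfree_idE)
qed

lemma inv_g_sym: "q \<in> U \<Longrightarrow> inv (g q) u \<bullet> v = u \<bullet> inv (g q) v"
  using g_sym[of q "inv (g q) u" "inv (g q) v"] by simp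

lemma coord_differentiable_g: "coord_differentiable c (\<lambda>q. g q v) p"
  by (rule smooth_field_coord_differentiable) (use metric in \<open>simp add: metric_structure_def\<close>)

text \<open>Cramer's rule writes the components of the inverse as quotients of determinants, with a
  denominator that does not vanish at \<open>p\<close>.\<close>

lemma coord_differentiable_inv_g: "coord_differentiable c (\<lambda>q. inv (g q) v) p"
proof -
  have comp: "coord_differentiable c (\<lambda>q. matrix (g q) $ i $ j) p" for i j
    using coord_differentiable_nth(1)[OF coord_differentiable_g[of "axis j 1"], of i]
    by (simp add: matrix_def)
  have quot: "coord_differentiable c (\<lambda>q. F q / K q) p"
    if "coord_differentiable c F p" "coord_differentiable c K p" "K p \<noteq> 0"
    for F K :: "'m \<Rightarrow> real"
    using that differentiable_divide[of "F \<circ> chart_inv c" "snd c p" UNIV "K \<circ> chart_inv c"] p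
    by (simp add: coord_differentiable_def o_def)
  have "coord_differentiable c (\<lambda>q. (\<chi> k. det (\<chi> i j. if j = k then v $ i else matrix (g q) $ i $ j)
      / det (matrix (g q)))) p"
  proof (rule coord_differentiable_vecI)
    fix k
    have "coord_differentiable c (\<lambda>q. det (\<chi> i j. if j = k then v $ i else matrix (g q) $ i $ j)) p"
    proof (intro coord_differentiable_det coord_differentiable_vecI)
      show "coord_differentiable c (\<lambda>q. (\<chi> i j. if j = k then v $ i else matrix (g q) $ i $ j) $ i $ j) p"
        for i j by (cases "j = k") (simp_all add: comp)
    qed
    moreover have "coord_differentiable c (\<lambda>q. det (matrix (g q))) p"
      by (intro coord_differentiable_det coord_differentiable_vecI comp)
    ultimately show "coord_differentiable c (\<lambda>q. (\<chi> k. det (\<chi> i j. if j = k then v $ i else matrix (g q) $ i $ j)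
      / det (matrix (g q))) $ k) p"
      using det_g[OF p] by (simp add: quot)
  qed
  moreover have "inv (g q) v = (\<chi> k. det (\<chi> i j. if j = k then v $ i else matrix (g q) $ i $ j)
      / det (matrix (g q)))" if "q \<in> U" for q
    using cramer[OF det_g[OF that], of "inv (g q) v" v] that
    by (simp add: matrix_works linear_g)
  ultimately show ?thesis
    by (subst coord_differentiable_cong_on(1))
qed

section \<open>Derivatives of the metric and the Christoffel endomorphism\<close>

abbreviation "dg \<mu> v \<equiv> pd c \<mu> (\<lambda>q. g q v) p"

abbreviation "lc \<equiv> christoffel (inv (g p)) dg"

lemma linear_dg: "linear (dg \<mu>)"
  by (rule linear_pd_endo[OF linear_g coord_differentiable_g])

lemma dg_sym: "dg \<mu> u \<bullet> v = u \<bullet> dg \<mu> v"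
proof -
  have "dg \<mu> u \<bullet> v = pd c \<mu> (\<lambda>q. g q u \<bullet> v) p"
    by (rule coord_differentiable_linear(2)[OF bounded_linear_inner_left coord_differentiable_g, symmetric])
  also have "\<dots> = pd c \<mu> (\<lambda>q. u \<bullet> g q v) p"
    by (rule coord_differentiable_cong_on(2)[OF g_sym])
  also have "\<dots> = u \<bullet> dg \<mu> v"
    by (rule coord_differentiable_linear(2)[OF bounded_linear_inner_right coord_differentiable_g])
  finally show ?thesis .
qed

text \<open>Differentiates the constant field \<open>g q (inv (g q) v)\<close>. The outer
  \<open>g p\<close> stays because conjugation by the metric will supply it.\<close>

lemma pd_inv_g: "g p (pd c \<mu> (\<lambda>q. inv (g q) v) p) = - dg \<mu> (inv (g p) v)"
proof -
  have "pd c \<mu> (\<lambda>q. g q (inv (g q) v)) p = pd c \<mu> (\<lambda>q. v) p"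
    by (rule coord_differentiable_cong_on(2)) simp
  then show ?thesis
    using coord_differentiable_endo(2)[OF linear_g coord_differentiable_g coord_differentiable_inv_g, of \<mu> v]
    by (simp add: add_eq_0_iff)
qed

lemma linear_lc: "linear (lc a)"
proof -
  have "linear (\<lambda>b. \<Sum>\<mu>\<in>UNIV. (a $ \<mu>) *\<^sub>R dg \<mu> b + (b $ \<mu>) *\<^sub>R dg \<mu> a - (a \<bullet> dg \<mu> b) *\<^sub>R bvec \<mu>)"
    by (rule linearI)
      (simp_all add: linear_add[OF linear_dg] linear_cmul[OF linear_dg] inner_add_right algebra_simps
        sum.distrib sum_subtractf scaleR_sum_right)
  from linear_compose_scale_right[OF linear_o[OF this linear_inv_g[OF p]]] show ?thesis
    unfolding christoffel_def .
qed

text \<open>Lowering the index removes the inverse metric and leaves the Christoffel symbols of the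
  first kind.\<close>

lemma g_lc_inner:
  "g p (lc a b) \<bullet> v = (1/2) * (\<Sum>\<mu>\<in>UNIV. a $ \<mu> * (dg \<mu> b \<bullet> v) + b $ \<mu> * (dg \<mu> a \<bullet> v) - (a \<bullet> dg \<mu> b) * v $ \<mu>)"
  by (simp add: christoffel_def linear_cmul[OF linear_g[OF p]] p inner_sum_left inner_add_left
      inner_diff_left inner_bvec)

text \<open>Torsion-freeness: the first two terms trade places, and the third is symmetric because
  \<open>dg \<mu>\<close> is self-adjoint.\<close>

lemma lc_commute: "lc a b = lc b a"
  by (simp add: christoffel_def add.commute dg_sym inner_commute[of a] )

text \<open>Metric compatibility: in the sum over both orders of \<open>u\<close> and
  \<open>v\<close>, the second Christoffel term of each order cancels the third term of the
  other.\<close>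

lemma lc_compatible: "g p (lc (bvec \<mu>) u) \<bullet> v + u \<bullet> g p (lc (bvec \<mu>) v) = dg \<mu> u \<bullet> v"
proof -
  have "g p (lc a u) \<bullet> v + g p (lc a v) \<bullet> u = (\<Sum>\<nu>\<in>UNIV. a $ \<nu> * (dg \<nu> u \<bullet> v))" for a
    unfolding g_lc_inner distrib_left[symmetric] sum.distrib[symmetric] sum_distrib_left
    by (rule sum.cong) (simp_all add: dg_sym[of _ u] dg_sym[of _ a] inner_commute[of "dg _ v"] algebra_simps)
  from this[of "bvec \<mu>"] show ?thesis
    by (simp add: bvec_nth inner_commute[of u] mult_delta_left)
qed

text \<open>In the trace the last two Christoffel terms agree and cancel. What remains is the form
  in which Jacobi's formula delivers the logarithmic differential of the density.\<close>

lemma trace_lc: "(\<Sum>\<nu>\<in>UNIV. lc (bvec \<mu>) (bvec \<nu>) $ \<nu>) = (1/2) * (\<Sum>\<nu>\<in>UNIV. dg \<mu> (inv (g p) (bvec \<nu>)) $ \<nu>)"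
proof -
  let ?h = "inv (g p)"
  have "lc (bvec \<mu>) (bvec \<nu>) $ \<nu> = (1/2) * (dg \<mu> (?h (bvec \<nu>)) $ \<nu>
      + dg \<nu> (bvec \<mu>) \<bullet> ?h (bvec \<nu>) - (\<Sum>l\<in>UNIV. (dg l (bvec \<mu>) $ \<nu>) * ?h (bvec l) $ \<nu>))" for \<nu>
  proof -
    have 1: "bvec \<mu> \<bullet> dg l (bvec \<nu>) = dg l (bvec \<mu>) $ \<nu>" for l
      by (simp add: dg_sym[symmetric] inner_bvec)
    have 2: "?h (bvec \<nu>) $ l = ?h (bvec l) $ \<nu>" for l
      using inv_g_sym[OF p, of "bvec \<nu>" "bvec l"] by (simp add: inner_bvec)
    have "lc (bvec \<mu>) (bvec \<nu>) $ \<nu> = g p (lc (bvec \<mu>) (bvec \<nu>)) \<bullet> ?h (bvec \<nu>)"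
      by (simp add: g_sym p inner_bvec)
    also have "\<dots> = (1/2) * (dg \<mu> (bvec \<nu>) \<bullet> ?h (bvec \<nu>) + dg \<nu> (bvec \<mu>) \<bullet> ?h (bvec \<nu>)
        - (\<Sum>l\<in>UNIV. (bvec \<mu> \<bullet> dg l (bvec \<nu>)) * ?h (bvec \<nu>) $ l))"
      unfolding g_lc_inner by (simp add: sum.distrib sum_subtractf bvec_nth mult_delta_left)
    also have "dg \<mu> (bvec \<nu>) \<bullet> ?h (bvec \<nu>) = dg \<mu> (?h (bvec \<nu>)) $ \<nu>"
      by (simp add: dg_sym inner_bvec)
    finally show ?thesis by (simp only: 1 2)
  qed
  then have "(\<Sum>\<nu>\<in>UNIV. lc (bvec \<mu>) (bvec \<nu>) $ \<nu>) = (1/2) * ((\<Sum>\<nu>\<in>UNIV. dg \<mu> (?h (bvec \<nu>)) $ \<nu>)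
      + (\<Sum>\<nu>\<in>UNIV. dg \<nu> (bvec \<mu>) \<bullet> ?h (bvec \<nu>))
      - (\<Sum>\<nu>\<in>UNIV. \<Sum>l\<in>UNIV. (dg l (bvec \<mu>) $ \<nu>) * ?h (bvec l) $ \<nu>))"
    by (simp only: sum_distrib_left[symmetric] sum.distrib sum_subtractf)
  also have "(\<Sum>\<nu>\<in>UNIV. \<Sum>l\<in>UNIV. (dg l (bvec \<mu>) $ \<nu>) * ?h (bvec l) $ \<nu>)
      = (\<Sum>l\<in>UNIV. dg l (bvec \<mu>) \<bullet> ?h (bvec l))"
    by (subst sum.swap) (simp add: inner_vec_def)
  finally show ?thesis by simp
qed

lemma ddir_endo_const: "ddir_endo c a g (\<lambda>_. b) p = (\<Sum>\<mu>\<in>UNIV. (a $ \<mu>) *\<^sub>R dg \<mu> b)"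
  by (simp add: ddir_endo_def ddir_def inner_bvec linear_0[OF linear_g[OF p]])

text \<open>The first term of \<open>levi_civita\<close> gives the derivative of the metric along
  \<open>a\<close>; contracting the bivector \<open>omega0\<close> gives the two other Christoffel
  terms, collected in \<open>V\<close>.\<close>

lemma levi_civita_eq_lc: "levi_civita c g a p b = of_vec (lc a b)"
proof -
  let ?h = "inv (g p)"
  define C where "C \<mu> \<nu> = a \<bullet> (dg \<mu> (bvec \<nu>) - dg \<nu> (bvec \<mu>))" for \<mu> \<nu>
  define V where "V = (\<Sum>\<mu>\<in>UNIV. (b $ \<mu>) *\<^sub>R dg \<mu> a - (a \<bullet> dg \<mu> b) *\<^sub>R bvec \<mu>)"
  have contr: "of_vec (g p b) \<^bold>\<rfloor> (of_vec (?h (bvec \<mu>)) \<^bold>\<and> of_vec (?h (bvec \<nu>))) =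
      of_vec (?h ((b $ \<mu>) *\<^sub>R bvec \<nu> - (b $ \<nu>) *\<^sub>R bvec \<mu>))" for \<mu> \<nu>
    by (simp add: of_vec_lcontr_of_vec_wedge of_vec_lcontr_of_vec g_sym p inner_bvec
        linear_cmul[OF linear_wedge_right] linear_diff[OF linear_inv_g] linear_cmul[OF linear_inv_g]
        linear_diff[OF linear_of_vec] linear_cmul[OF linear_of_vec])
  \<comment> \<open>Since \<open>C\<close> is antisymmetric, the two halves of the contracted
    bivector contribute equally, whence the factor 2 in \<open>CV\<close>.\<close>
  have "(\<Sum>\<mu>\<in>UNIV. \<Sum>\<nu>\<in>UNIV. C \<mu> \<nu> *\<^sub>R ((b $ \<nu>) *\<^sub>R bvec \<mu>)) =
      - (\<Sum>\<mu>\<in>UNIV. \<Sum>\<nu>\<in>UNIV. C \<mu> \<nu> *\<^sub>R ((b $ \<mu>) *\<^sub>R bvec \<nu>))"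
    unfolding sum_negf[symmetric]
    by (subst sum.swap, intro sum.cong refl) (simp add: C_def inner_diff_right algebra_simps)
  moreover have "(\<Sum>\<mu>\<in>UNIV. \<Sum>\<nu>\<in>UNIV. C \<mu> \<nu> *\<^sub>R ((b $ \<mu>) *\<^sub>R bvec \<nu>)) = V"
  proof -
    have "(\<Sum>\<mu>\<in>UNIV. \<Sum>\<nu>\<in>UNIV. (a \<bullet> dg \<mu> (bvec \<nu>)) *\<^sub>R ((b $ \<mu>) *\<^sub>R bvec \<nu>))
        = (\<Sum>\<mu>\<in>UNIV. (b $ \<mu>) *\<^sub>R dg \<mu> a)"
    proof (rule sum.cong)
      fix \<mu>
      have "(\<Sum>\<nu>\<in>UNIV. (a \<bullet> dg \<mu> (bvec \<nu>)) *\<^sub>R ((b $ \<mu>) *\<^sub>R bvec \<nu>))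
          = (b $ \<mu>) *\<^sub>R (\<Sum>\<nu>\<in>UNIV. (dg \<mu> a $ \<nu>) *\<^sub>R bvec \<nu>)"
        by (simp add: dg_sym[symmetric] inner_bvec scaleR_sum_right mult.commute)
      then show "(\<Sum>\<nu>\<in>UNIV. (a \<bullet> dg \<mu> (bvec \<nu>)) *\<^sub>R ((b $ \<mu>) *\<^sub>R bvec \<nu>)) = (b $ \<mu>) *\<^sub>R dg \<mu> a"
        by (simp only: sum_bvec)
    qed simp
    moreover have "(\<Sum>\<mu>\<in>UNIV. \<Sum>\<nu>\<in>UNIV. (a \<bullet> dg \<nu> (bvec \<mu>)) *\<^sub>R ((b $ \<mu>) *\<^sub>R bvec \<nu>))
        = (\<Sum>\<nu>\<in>UNIV. (a \<bullet> dg \<nu> b) *\<^sub>R bvec \<nu>)"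
    proof (subst sum.swap, rule sum.cong)
      fix \<nu>
      have "a \<bullet> dg \<nu> (\<Sum>\<mu>\<in>UNIV. (b $ \<mu>) *\<^sub>R bvec \<mu>) = (\<Sum>\<mu>\<in>UNIV. b $ \<mu> * (a \<bullet> dg \<nu> (bvec \<mu>)))"
        by (simp add: linear_sum[OF linear_dg] linear_cmul[OF linear_dg] inner_sum_right)
      then show "(\<Sum>\<mu>\<in>UNIV. (a \<bullet> dg \<nu> (bvec \<mu>)) *\<^sub>R ((b $ \<mu>) *\<^sub>R bvec \<nu>)) = (a \<bullet> dg \<nu> b) *\<^sub>R bvec \<nu>"
        by (simp add: sum_bvec mult.commute flip: scaleR_sum_left)
    qed simp
    ultimately show ?thesis
      by (simp only: C_def V_def inner_diff_right scaleR_diff_left sum_subtractf)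
  qed
  ultimately have CV: "(\<Sum>\<mu>\<in>UNIV. \<Sum>\<nu>\<in>UNIV. C \<mu> \<nu> *\<^sub>R ((b $ \<mu>) *\<^sub>R bvec \<nu> - (b $ \<nu>) *\<^sub>R bvec \<mu>)) = 2 *\<^sub>R V"
    by (simp only: scaleR_diff_right sum_subtractf) (simp add: scaleR_2)
  note L = linear_of_vec linear_inv_g[OF p]
  \<comment> \<open>The minus signs of \<open>gcross\<close> and \<open>omega0\<close> cancel; the
    quarter and the factor 2 will combine to the half in \<open>christoffel\<close>.\<close>
  have "gcross (g p) (omega0 c g a p) b = (1/4) *\<^sub>R (\<Sum>\<mu>\<in>UNIV. \<Sum>\<nu>\<in>UNIV. C \<mu> \<nu> *\<^sub>R
      of_vec (?h ((b $ \<mu>) *\<^sub>R bvec \<nu> - (b $ \<nu>) *\<^sub>R bvec \<mu>)))"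
    by (simp only: gcross_def omega0_def linear_cmul[OF linear_lcontr] linear_sum[OF linear_lcontr] contr
        C_def[symmetric] ddir_endo_def ddir_bvec pd_const linear_0[OF linear_g[OF p]] diff_zero)
      simp
  also have "\<dots> = (1/4) *\<^sub>R of_vec (?h (\<Sum>\<mu>\<in>UNIV. \<Sum>\<nu>\<in>UNIV. C \<mu> \<nu> *\<^sub>R
      ((b $ \<mu>) *\<^sub>R bvec \<nu> - (b $ \<nu>) *\<^sub>R bvec \<mu>)))"
    by (simp only: L[THEN linear_sum] L[THEN linear_cmul])
  also have "\<dots> = of_vec ((1/2) *\<^sub>R ?h V)"
    by (simp add: CV L[THEN linear_cmul])
  finally have "levi_civita c g a p b = of_vec ((1/2) *\<^sub>R ?h ((\<Sum>\<mu>\<in>UNIV. (a $ \<mu>) *\<^sub>R dg \<mu> b) + V))"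
    by (simp add: levi_civita_def ddir_endo_const L[THEN linear_add] scaleR_add_right)
  also have "(\<Sum>\<mu>\<in>UNIV. (a $ \<mu>) *\<^sub>R dg \<mu> b) + V
      = (\<Sum>\<mu>\<in>UNIV. (a $ \<mu>) *\<^sub>R dg \<mu> b + (b $ \<mu>) *\<^sub>R dg \<mu> a - (a \<bullet> dg \<mu> b) *\<^sub>R bvec \<mu>)"
    by (simp add: V_def sum.distrib sum_subtractf)
  finally show ?thesis by (simp add: christoffel_def)
qed

lemma Lambda_eq: "Lambda c g a p = derivation_ext (lc a)"
  by (simp add: fun_eq_iff Lambda_def derivation_ext_def levi_civita_eq_lc)


section \<open>The covariant divergence\<close>

abbreviation "lowered X q \<equiv> outermorphism (inv (g q)) (X q)"

lemma outermorphism_g_inv_g: "outermorphism (g p) (outermorphism (inv (g p)) X) = X"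
  using outermorphism_compose[OF linear_g[OF p] linear_inv_g[OF p], of X] outermorphism_ident[of X] p
  by (simp add: o_def)

lemma outermorphism_inv_g_g: "outermorphism (inv (g p)) (outermorphism (g p) X) = X"
  using outermorphism_compose[OF linear_inv_g[OF p] linear_g[OF p], of X] outermorphism_ident[of X] p
  by (simp add: o_def)

lemma coord_differentiable_lowered:
  assumes "coord_differentiable c X p"
  shows "coord_differentiable c (lowered X) p"
    "pd c \<mu> (lowered X) p = derivation_ext (\<lambda>v. pd c \<mu> (\<lambda>q. inv (g q) (g p v)) p) (lowered X p)
      + outermorphism (inv (g p)) (pd c \<mu> X p)"
  using coord_differentiable_outermorphism[OF linear_inv_g coord_differentiable_inv_g linear_g[OF p] _ assms] p
  by simp_all

text \<open>Metric compatibility of the connection, lifted to multivectors.\<close>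

lemma Dminus_eq_Dplus:
  assumes X: "coord_differentiable c X p"
  shows "Dminus c g (bvec \<mu>) X p = outermorphism (g p) (Dplus c g (bvec \<mu>) (lowered X) p)"
proof -
  let ?h = "inv (g p)"
  define s where "s = lc (bvec \<mu>)"
  have s: "linear s" unfolding s_def by (rule linear_lc)
  have conj: "outermorphism (g p) (derivation_ext f (lowered X p)) = derivation_ext (\<lambda>v. g p (f (?h v))) (X p)"
    if "linear f" for f
    by (rule derivation_ext_conj) (simp_all add: linear_g linear_inv_g p that)
  have 1: "outermorphism (g p) (derivation_ext (\<lambda>v. pd c \<mu> (\<lambda>q. inv (g q) (g p v)) p) (lowered X p))
      = derivation_ext (\<lambda>v. - dg \<mu> (?h v)) (X p)"
  proof (subst conj)
    show "linear (\<lambda>v. pd c \<mu> (\<lambda>q. inv (g q) (g p v)) p)"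
      by (rule linear_o[OF linear_g[OF p] linear_pd_endo[OF linear_inv_g coord_differentiable_inv_g]])
  qed (simp_all add: pd_inv_g p)
  \<comment> \<open>Compatibility cancels the derivative of the metric, and the symmetry of the
    inverse metric exposes the remainder as minus the adjoint of \<open>s\<close>.\<close>
  have "(- dg \<mu> (?h v) + g p (s (?h v))) \<bullet> w = - adjoint s v \<bullet> w" for v w
    using lc_compatible[of \<mu> "?h v" w] inv_g_sym[OF p, of v "g p (s w)"] adjoint_clauses(2)[OF s, of v w] p
    by (simp add: s_def inner_diff_left inner_add_left)
  then have 2: "- dg \<mu> (?h v) + g p (s (?h v)) = - adjoint s v" for v
    by (rule inner_eqI)
  have 3: "adjoint (derivation_ext s) (X p) = derivation_ext (adjoint s) (X p)"
    by (rule inner_eqI)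
      (simp add: adjoint_clauses(2)[OF linear_derivation_ext]
        derivation_ext_adjoint[of "adjoint s" s, OF adjoint_clauses(2)[OF s]])
  have "outermorphism (g p) (Dplus c g (bvec \<mu>) (lowered X) p)
      = derivation_ext (\<lambda>v. - dg \<mu> (?h v)) (X p) + pd c \<mu> X p + derivation_ext (\<lambda>v. g p (s (?h v))) (X p)"
    by (simp add: Dplus_def Lambda_eq coord_differentiable_lowered[OF X] linear_add[OF linear_outermorphism]
        outermorphism_g_inv_g 1 conj[OF s] flip: s_def)
  also have "\<dots> = pd c \<mu> X p + derivation_ext (\<lambda>v. - dg \<mu> (?h v) + g p (s (?h v))) (X p)"
    by (simp only: derivation_ext_add add_ac)
  also have "\<dots> = Dminus c g (bvec \<mu>) X p"
    by (simp only: 2 derivation_ext_uminus Dminus_def Lambda_eq s_def[symmetric] 3 ddir_bvec) simp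
  finally show ?thesis ..
qed

text \<open>The contraction by the raised basis vector passes through the outermorphism of the
  metric and becomes contraction by the basis vector.\<close>

lemma Dminus_div_eq_Dplus_div:
  assumes "coord_differentiable c X p"
  shows "Dminus_div c g X p = outermorphism (g p) (Dplus_div c g (lowered X) p)"
proof -
  have "of_vec (inv (g p) (bvec \<mu>)) \<^bold>\<rfloor> outermorphism (g p) Y = outermorphism (g p) (of_vec (bvec \<mu>) \<^bold>\<rfloor> Y)" for \<mu> Y
    by (rule lcontr_outermorphism[OF linear_g[OF p]]) (simp add: inv_g_sym p)
  then show ?thesis
    by (simp add: Dminus_div_def Dplus_div_def Dminus_eq_Dplus[OF assms] linear_sum[OF linear_outermorphism])
qed

text \<open>Jacobi's formula: the rule for outermorphisms is applied to the constant pseudoscalar,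
  on which the derivation extension acts by the trace.\<close>

lemma coord_differentiable_det_g:
  shows "coord_differentiable c (\<lambda>q. det (matrix (g q))) p"
    "pd c \<mu> (\<lambda>q. det (matrix (g q))) p
       = det (matrix (g p)) * (\<Sum>\<nu>\<in>UNIV. dg \<mu> (inv (g p) (bvec \<nu>)) $ \<nu>)"
proof -
  have det: "det (matrix (g q)) = outermorphism (g q) (blade UNIV) $ UNIV" for q
    by (simp only: outermorphism_pseudoscalar) (simp add: blade_def)
  note * = coord_differentiable_outermorphism[OF linear_g coord_differentiable_g linear_inv_g[OF p] inv_g_g[OF p]
      coord_differentiable_const[where k = "blade UNIV"]]
  show "coord_differentiable c (\<lambda>q. det (matrix (g q))) p"
    unfolding det by (rule coord_differentiable_nth(1)[OF *(1)])
  have "pd c \<mu> (\<lambda>q. det (matrix (g q))) p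
      = derivation_ext (\<lambda>v. dg \<mu> (inv (g p) v)) (outermorphism (g p) (blade UNIV)) $ UNIV"
    by (simp only: det coord_differentiable_nth(2)[OF *(1)] *(2))
      (simp add: linear_0[OF linear_outermorphism])
  also have "\<dots> = det (matrix (g p)) * (\<Sum>\<nu>\<in>UNIV. dg \<mu> (inv (g p) (bvec \<nu>)) $ \<nu>)"
    by (simp only: outermorphism_pseudoscalar linear_cmul[OF linear_derivation_ext]
        derivation_ext_pseudoscalar) (simp add: blade_def)
  finally show "pd c \<mu> (\<lambda>q. det (matrix (g q))) p
       = det (matrix (g p)) * (\<Sum>\<nu>\<in>UNIV. dg \<mu> (inv (g p) (bvec \<nu>)) $ \<nu>)" .
qed

lemma metric_density_pos: "q \<in> U \<Longrightarrow> metric_density g q > 0"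
  using det_g by (simp add: metric_density_def)

text \<open>The half produced by the square root matches the half in
  \<open>trace_lc\<close>.\<close>

lemma coord_differentiable_metric_density:
  shows "coord_differentiable c (metric_density g) p"
    "pd c \<mu> (metric_density g) p = metric_density g p * (\<Sum>\<nu>\<in>UNIV. lc (bvec \<mu>) (bvec \<nu>) $ \<nu>)"
proof -
  let ?d = "det (matrix (g p))"
  have "((\<lambda>x. sqrt \<bar>x\<bar>) has_real_derivative sqrt \<bar>?d\<bar> / (2 * ?d)) (at ?d)"
    by (rule has_real_derivative_sqrt_abs) (rule det_g[OF p])
  note * = coord_differentiable_chain[OF coord_differentiable_det_g(1) this chart_inv_coord[OF p]]
  show "coord_differentiable c (metric_density g) p"
    using *(1) by (simp add: metric_density_def[abs_def])
  show "pd c \<mu> (metric_density g) p = metric_density g p * (\<Sum>\<nu>\<in>UNIV. lc (bvec \<mu>) (bvec \<nu>) $ \<nu>)"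
    using *(2)[of \<mu>] det_g[OF p]
    by (simp add: metric_density_def[abs_def] coord_differentiable_det_g(2) trace_lc)
qed

lemma coord_differentiable_density_scaleR:
  assumes "coord_differentiable c X p"
  shows "coord_differentiable c (\<lambda>q. metric_density g q *\<^sub>R X q) p"
    "pd c \<mu> (\<lambda>q. metric_density g q *\<^sub>R X q) p
       = metric_density g p *\<^sub>R pd c \<mu> X p + pd c \<mu> (metric_density g) p *\<^sub>R X p"
  by (rule coord_differentiable_scaleR[OF coord_differentiable_metric_density(1) assms])+

text \<open>By the product rule the density contributes a contraction of \<open>Y\<close> with the
  trace of the connection, and torsion-freeness makes the connection terms of
  \<open>Dplus_div\<close> add up to the same contraction.\<close>

lemma Dplus_div_eq_canonical_div:
  assumes "coord_differentiable c Y p"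
  shows "Dplus_div c g Y p
    = (1 / metric_density g p) *\<^sub>R canonical_div c (\<lambda>q. metric_density g q *\<^sub>R Y q) p"
proof -
  note L = linear_lcontr
  have "canonical_div c (\<lambda>q. metric_density g q *\<^sub>R Y q) p
      = metric_density g p *\<^sub>R (canonical_div c Y p
          + (\<Sum>\<mu>\<in>UNIV. (\<Sum>\<nu>\<in>UNIV. lc (bvec \<mu>) (bvec \<nu>) $ \<nu>) *\<^sub>R (of_vec (bvec \<mu>) \<^bold>\<rfloor> Y p)))"
    by (simp add: canonical_div_def coord_differentiable_density_scaleR(2)[OF assms]
        coord_differentiable_metric_density(2) L[THEN linear_add] L[THEN linear_cmul] sum.distrib
        scaleR_add_right scaleR_sum_right)
  also have "(\<Sum>\<mu>\<in>UNIV. (\<Sum>\<nu>\<in>UNIV. lc (bvec \<mu>) (bvec \<nu>) $ \<nu>) *\<^sub>R (of_vec (bvec \<mu>) \<^bold>\<rfloor> Y p))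
      = (\<Sum>\<mu>\<in>UNIV. of_vec (bvec \<mu>) \<^bold>\<rfloor> derivation_ext (lc (bvec \<mu>)) (Y p))"
    by (rule sum_lcontr_derivation_ext[symmetric]) (rule lc_commute)
  also have "canonical_div c Y p + \<dots> = Dplus_div c g Y p"
    by (simp add: canonical_div_def Dplus_div_def Dplus_def Lambda_eq L[THEN linear_add] sum.distrib)
  finally show ?thesis using metric_density_pos[OF p] by simp
qed

lemma Dminus_div_eq_canonical_div:
  assumes "coord_differentiable c X p"
  shows "Dminus_div c g X p = (1 / metric_density g p) *\<^sub>R
    outermorphism (g p) (canonical_div c (\<lambda>q. metric_density g q *\<^sub>R lowered X q) p)"
  by (simp add: Dminus_div_eq_Dplus_div[OF assms]
      Dplus_div_eq_canonical_div[OF coord_differentiable_lowered(1)[OF assms]]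
      linear_cmul[OF linear_outermorphism])


section \<open>The Hodge coderivative\<close>

lemma wedge_fam_nth_reciprocal:
  fixes v w :: "'n \<Rightarrow> 'n canonical_space"
  assumes "\<And>\<mu> \<nu>. v \<mu> \<bullet> w \<nu> = (if \<mu> = \<nu> then 1 else 0)"
  shows "wedge_fam v $ UNIV * wedge_fam w $ UNIV = 1"
proof -
  have "wedge_fam v \<bullet> wedge_fam w = wedge_fam v $ UNIV * wedge_fam w $ UNIV"
    by (simp add: wedge_fam_eq_det[of v] wedge_fam_eq_det[of w] blade_def inner_axis_axis)
  moreover have "(\<chi> i j. v i \<bullet> w j) = mat 1"
    by (simp add: assms mat_def)
  ultimately show ?thesis using inner_wedge_fam[of v w] by simp
qed

text \<open>With \<open>a\<close> and \<open>b\<close> the pseudoscalar coefficients of the two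
  frames, the square root is the absolute value of \<open>a\<close>, and reciprocity gives
  \<open>a * b = 1\<close>; only the sign of \<open>b\<close> remains.\<close>

lemma volume_element_eq_sgn:
  fixes e e' :: "'n \<Rightarrow> 'm \<Rightarrow> 'n canonical_space"
  assumes "\<And>\<mu> \<nu>. e \<mu> q \<bullet> e' \<nu> q = (if \<mu> = \<nu> then 1 else 0)"
  shows "volume_element e e' q = sgn (wedge_fam (\<lambda>\<mu>. e' \<mu> q) $ UNIV) *\<^sub>R blade UNIV"
proof -
  define a b where "a = wedge_fam (\<lambda>\<mu>. e \<mu> q) $ UNIV" and "b = wedge_fam (\<lambda>\<mu>. e' \<mu> q) $ UNIV"
  have ab: "wedge_fam (\<lambda>\<mu>. e \<mu> q) = a *\<^sub>R blade UNIV" "wedge_fam (\<lambda>\<mu>. e' \<mu> q) = b *\<^sub>R blade UNIV"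
    unfolding a_def b_def by (simp_all add: wedge_fam_eq_det blade_def)
  have "a * b = 1" unfolding a_def b_def by (rule wedge_fam_nth_reciprocal) (rule assms)
  then have "\<bar>a\<bar> * \<bar>b\<bar> = 1" "b \<noteq> 0" by (auto simp flip: abs_mult)
  then have "\<bar>a\<bar> * b = sgn b" by (auto simp: sgn_if abs_if split: if_splits)
  then show ?thesis
    by (simp add: volume_element_def ab blade_def inner_axis_axis flip: power2_eq_square)
qed

text \<open>A nonvanishing continuous coefficient keeps its sign near \<open>p\<close>, so the
  volume element can be treated as constant there. The statement is local because \<open>U\<close>
  may be disconnected.\<close>

lemma eventually_volume_element:
  assumes "reciprocal_frame_fields c U e e'"
  obtains \<sigma> :: real where "\<sigma> \<noteq> 0" "volume_element e e' p = \<sigma> *\<^sub>R blade UNIV"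
    "\<forall>\<^sub>F y in nhds (snd c p). volume_element e e' (chart_inv c y) = \<sigma> *\<^sub>R blade UNIV"
proof -
  define b where "b q = wedge_fam (\<lambda>\<mu>. e' \<mu> q) $ UNIV" for q
  have rec: "e \<mu> q \<bullet> e' \<nu> q = (if \<mu> = \<nu> then 1 else 0)" if "q \<in> U" for \<mu> \<nu> q
    using assms that by (auto simp: reciprocal_frame_fields_def)
  have vol: "volume_element e e' q = sgn (b q) *\<^sub>R blade UNIV" if "q \<in> U" for q
    unfolding b_def by (rule volume_element_eq_sgn) (rule rec[OF that])
  have nz: "b p \<noteq> 0"
    using wedge_fam_nth_reciprocal[of "\<lambda>\<mu>. e \<mu> p" "\<lambda>\<mu>. e' \<mu> p", OF rec[OF p]] by (auto simp: b_def)
  have "coord_differentiable c (e' \<mu>) p" for \<mu>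
    using assms by (intro smooth_field_coord_differentiable)
      (auto simp: reciprocal_frame_fields_def frame_field_def)
  then have "coord_differentiable c b p"
    unfolding b_def wedge_fam_def
    by (intro coord_differentiable_nth coord_differentiable_wedge_list)
  then have "isCont (b \<circ> chart_inv c) (snd c p)"
    unfolding coord_differentiable_def by (rule differentiable_imp_continuous_within)
  then have "((b \<circ> chart_inv c) \<longlongrightarrow> b p) (nhds (snd c p))"
    unfolding continuous_at tendsto_at_iff_tendsto_nhds using p by simp
  \<comment> \<open>Multiplying by \<open>b p\<close> turns equality of signs into positivity of a
    limit.\<close>
  then have "((\<lambda>y. b (chart_inv c y) * b p) \<longlongrightarrow> b p * b p) (nhds (snd c p))"
    by (auto intro: tendsto_mult_right simp: o_def)
  moreover have "b p * b p > 0" using nz not_real_square_gt_zero by blast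
  ultimately have "\<forall>\<^sub>F y in nhds (snd c p). b (chart_inv c y) * b p > 0"
    by (rule order_tendstoD(1))
  then have "\<forall>\<^sub>F y in nhds (snd c p). volume_element e e' (chart_inv c y) = sgn (b p) *\<^sub>R blade UNIV"
    using eventually_chart_inv
  proof eventually_elim
    case (elim y)
    then show ?case using vol[OF elim(2)] by (auto simp: zero_less_mult_iff sgn_if)
  qed
  then show thesis
    using that[of "sgn (b p)"] vol[OF p] nz by (simp add: sgn_if)
qed

text \<open>With the density absorbed into the field, the star becomes a constant linear map near
  \<open>p\<close> and commutes with partial derivatives. Duality turns the curl into minus the
  divergence, and \<open>\<sigma>\<close> cancels when the star is inverted.\<close>

lemma hodge_coderivative_eq_canonical_div:
  assumes X: "coord_differentiable c X p"
    and "\<sigma> \<noteq> 0" and \<tau>p: "\<tau> p = \<sigma> *\<^sub>R blade UNIV"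
    and \<tau>: "\<forall>\<^sub>F y in nhds (snd c p). \<tau> (chart_inv c y) = \<sigma> *\<^sub>R blade UNIV"
  shows "hodge_coderivative c g \<tau> X p = - ((1 / metric_density g p) *\<^sub>R
    outermorphism (g p) (canonical_div c (\<lambda>q. metric_density g q *\<^sub>R lowered X q) p))"
proof -
  define dual where "dual Y = reversion Y \<^bold>\<rfloor> blade UNIV" for Y :: "'n multivector"
  have dual: "linear dual"
    unfolding dual_def by (rule linear_o[OF linear_reversion linear_lcontr_left])
  have star: "hodge_star g \<tau> q Y = (metric_density g q * \<sigma>) *\<^sub>R dual (outermorphism (inv (g q)) Y)"
    if "\<tau> q = \<sigma> *\<^sub>R blade UNIV" for q Y
    by (simp add: hodge_star_def that dual_def outermorphism_reversion linear_cmul[OF linear_lcontr])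
  \<comment> \<open>\<open>hodge_coderivative\<close> uses the function inverse of the star, which
    acts as a left inverse once the star is injective.\<close>
  have inj: "inj (hodge_star g \<tau> p)"
  proof (rule injI)
    fix Y Z
    assume "hodge_star g \<tau> p Y = hodge_star g \<tau> p Z"
    then have "dual (outermorphism (inv (g p)) (Y - Z)) = 0"
      using \<open>\<sigma> \<noteq> 0\<close> metric_density_pos[OF p]
      by (simp add: star \<tau>p linear_diff[OF linear_outermorphism] linear_diff[OF dual])
    then have "reversion (outermorphism (inv (g p)) (Y - Z)) = 0"
      unfolding dual_def by (rule lcontr_pseudoscalar_eq_0)
    then have "outermorphism (g p) (outermorphism (inv (g p)) (Y - Z)) = 0"
      by (metis linear_0 linear_outermorphism linear_reversion reversion_reversion)
    then show "Y = Z" by (simp add: outermorphism_g_inv_g)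
  qed
  define Y where "Y q = metric_density g q *\<^sub>R lowered X q" for q
  have Y: "coord_differentiable c Y p"
    unfolding Y_def by (rule coord_differentiable_density_scaleR(1)[OF coord_differentiable_lowered(1)[OF X]])
  \<comment> \<open>The part of the star that does not depend on the point; the metric sits entirely
    in \<open>Y\<close>.\<close>
  define f where "f Z = \<sigma> *\<^sub>R dual (grade_inv Z)" for Z
  have f: "bounded_linear f"
    unfolding f_def linear_conv_bounded_linear[symmetric]
    by (rule linear_compose_scale_right[OF linear_o[OF linear_grade_inv dual]])
  have "hodge_star g \<tau> (chart_inv c y) (grade_inv (X (chart_inv c y))) = f (Y (chart_inv c y))"
    if "\<tau> (chart_inv c y) = \<sigma> *\<^sub>R blade UNIV" for y
    by (simp add: star[OF that] f_def Y_def outermorphism_grade_inv linear_cmul[OF linear_grade_inv]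
        linear_cmul[OF dual] mult.commute)
  then have "\<forall>\<^sub>F y in nhds (snd c p).
      hodge_star g \<tau> (chart_inv c y) (grade_inv (X (chart_inv c y))) = f (Y (chart_inv c y))"
    by (rule eventually_mono[OF \<tau>])
  then have "canonical_curl c (\<lambda>q. hodge_star g \<tau> q (grade_inv (X q))) p
      = (\<Sum>\<mu>\<in>UNIV. of_vec (bvec \<mu>) \<^bold>\<and> f (pd c \<mu> Y p))"
    unfolding canonical_curl_def
    by (simp add: coord_differentiable_cong(2) coord_differentiable_linear(2)[OF f Y])
  also have "\<dots> = - (\<sigma> *\<^sub>R dual (canonical_div c Y p))"
    by (simp add: f_def dual_def canonical_div_def linear_cmul[OF linear_wedge_right] of_vec_wedge_dual
        linear_sum[OF linear_reversion] linear_sum[OF linear_lcontr_left] scaleR_sum_right sum_negf)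
  \<comment> \<open>The curl is exhibited as a star image: the density and the inverse metric inside
    the star are undone by the chosen argument.\<close>
  also have "\<dots> = hodge_star g \<tau> p (- ((1 / metric_density g p) *\<^sub>R outermorphism (g p) (canonical_div c Y p)))"
    using metric_density_pos[OF p]
    by (simp add: star[OF \<tau>p] linear_neg[OF linear_outermorphism] linear_cmul[OF linear_outermorphism]
        outermorphism_inv_g_g linear_neg[OF dual] linear_cmul[OF dual])
  finally show ?thesis
    unfolding hodge_coderivative_def by (simp add: inv_f_f[OF inj] Y_def[abs_def])
qed

end

theorem mainTheorem18:
  fixes \<A> :: "('m::{t2_space,second_countable_topology}, 'n::{finite,linorder}) chart set"
    and c :: "('m, 'n) chart"
    and U :: "'m set"
    and g :: "('m, 'n) endo_field"
    and X :: "'m \<Rightarrow> 'n multivector"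
  assumes "smooth_atlas \<A>"
    and "chart_of \<A> c"
    and "metric_structure c U g"
    and "X \<in> \<M> c U"
  shows "(\<forall>p\<in>U. Dminus_div c g X p
             = outermorphism (g p) (Dplus_div c g (\<lambda>q. outermorphism (inv (g q)) (X q)) p)) \<and>
         (\<forall>p\<in>U. Dminus_div c g X p
             = (1 / metric_density g p) *\<^sub>R
                 outermorphism (g p)
                   (canonical_div c
                     (\<lambda>q. metric_density g q *\<^sub>R outermorphism (inv (g q)) (X q)) p)) \<and>
         (\<forall>e e'. reciprocal_frame_fields c U e e' \<longrightarrow>
           (\<forall>p\<in>U. Dminus_div c g X p = - hodge_coderivative c g (volume_element e e') X p))"
proof -
  \<comment> \<open>All three identities are pointwise, so the locale results are instantiated at
    each point of \<open>U\<close> separately.\<close>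
  have point: "metric_point c U p g" if "p \<in> U" for p
    using that assms(2,3) by unfold_locales (auto simp: chart_of_def metric_structure_def)
  have diff: "coord_differentiable c X p" if "p \<in> U" for p
  proof -
    interpret metric_point c U p g by (rule point[OF that])
    show ?thesis using assms(4) by (intro smooth_field_coord_differentiable) (simp add: \<M>_def)
  qed
  have "Dminus_div c g X p = - hodge_coderivative c g (volume_element e e') X p"
    if frames: "reciprocal_frame_fields c U e e'" and "p \<in> U" for e e' p
  proof -
    interpret metric_point c U p g by (rule point[OF \<open>p \<in> U\<close>])
    obtain \<sigma> :: real where "\<sigma> \<noteq> 0" "volume_element e e' p = \<sigma> *\<^sub>R blade UNIV"
      "\<forall>\<^sub>F y in nhds (snd c p). volume_element e e' (chart_inv c y) = \<sigma> *\<^sub>R blade UNIV"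
      using eventually_volume_element[OF frames] by blast
    from hodge_coderivative_eq_canonical_div[OF diff[OF p] this] show ?thesis
      by (simp add: Dminus_div_eq_canonical_div[OF diff[OF p]])
  qed
  then show ?thesis
    using metric_point.Dminus_div_eq_Dplus_div[OF point diff]
      metric_point.Dminus_div_eq_canonical_div[OF point diff] by simp
qed

end
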